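(* Let $G$ be a finite group, let $\{U(g): g\in G\}$ be a unitary representation of $G$ on a Hilbert space $\mathcal{H}$, and let $|\psi\rangle,|\phi\rangle\in\mathcal{H}$ be unit vectors such that $\chi_\psi(g)\neq 0$ and $\chi_\phi(g)\neq 0$ for all $g\in G$. Then the pure states $\psi$ and $\phi$ are $G$-equivalent if and only if there exists a 1-dimensional unitary representation $g\mapsto e^{i\Theta(g)}$ of $G$ such that $$\forall g\in G:\quad \chi_\psi(g)=\chi_\phi(g)\,e^{i\Theta(g)}.$$
   Context: The characteristic function of a pure state $\psi$ is $\chi_\psi:G\to\mathbb{C}$, $\chi_\psi(g)=\langle\psi|U(g)|\psi\rangle$. A quantum channel is a linear, trace-preserving, completely positive map on operators. A channel $\mathcal{E}$ from operators on $\mathcal{H}$ to operators on $\mathcal{H}$ is $G$-covariant if $\mathcal{E}(U(g)XU^\dagger(g))=U(g)\mathcal{E}(X)U^\dagger(g)$ for all $g\in G$ and all $X$. For density operators $\rho,\sigma$ on $\mathcal{H}$, write $\rho\xrightarrow{G\text{-cov}}\sigma$ if there is a $G$-covariant channel $\mathcal{E}$ with $\mathcal{E}(\rho)=\sigma$. States $\rho$ and $\sigma$ are $G$-equivalent if $\rho\xrightarrow{G\text{-cov}}\sigma$ and $\sigma\xrightarrow{G\text{-cov}}\rho$. A pure state $\psi$ is identified with the density operator $|\psi\rangle\langle\psi|$. *)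

theory Defs
  imports "HOL-Analysis.Analysis" "HOL-Algebra.Group"
begin

section \<open>Complex Hilbert spaces\<close>

text \<open>The inner product is conjugate-linear in its first argument. The norm and the real inner
  product are tied to it by \<open>inner_eq_Re_cinner\<close>, so that \<open>cinner x x = (norm x)\<^sup>2\<close>. No restriction
  on the dimension is made.\<close>

class complex_hilbert_space = real_inner + complete_space +
  fixes scaleC :: "complex \<Rightarrow> 'a \<Rightarrow> 'a" (infixr "*\<^sub>C" 75)
    and cinner :: "'a \<Rightarrow> 'a \<Rightarrow> complex"
  assumes scaleC_of_real: "scaleC (complex_of_real r) x = r *\<^sub>R x"
    and scaleC_add_right: "scaleC c (x + y) = scaleC c x + scaleC c y"
    and scaleC_add_left: "scaleC (c + d) x = scaleC c x + scaleC d x"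
    and scaleC_scaleC: "scaleC c (scaleC d x) = scaleC (c * d) x"
    and cinner_commute: "cinner x y = cnj (cinner y x)"
    and cinner_add_right: "cinner x (y + z) = cinner x y + cinner x z"
    and cinner_scaleC_right: "cinner x (scaleC c y) = c * cinner x y"
    and inner_eq_Re_cinner: "inner x y = Re (cinner x y)"

instantiation complex :: complex_hilbert_space
begin

definition scaleC_complex :: "complex \<Rightarrow> complex \<Rightarrow> complex" where
  "scaleC_complex c z = c * z"

definition cinner_complex :: "complex \<Rightarrow> complex \<Rightarrow> complex" where
  "cinner_complex z w = cnj z * w"

instance
  by standard
    (auto simp: scaleC_complex_def cinner_complex_def inner_complex_def algebra_simps
      scaleR_conv_of_real)

end

section \<open>Operators\<close>

definition bounded_clinear :: "('h::complex_hilbert_space \<Rightarrow> 'h) \<Rightarrow> bool" where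
  "bounded_clinear A \<longleftrightarrow> bounded_linear A \<and> (\<forall>c x. A (c *\<^sub>C x) = c *\<^sub>C A x)"

definition cadjoint :: "('h::complex_hilbert_space \<Rightarrow> 'h) \<Rightarrow> 'h \<Rightarrow> 'h" where
  "cadjoint A = (THE B. \<forall>x y. cinner (B x) y = cinner x (A y))"

definition unitary_op :: "('h::complex_hilbert_space \<Rightarrow> 'h) \<Rightarrow> bool" where
  "unitary_op A \<longleftrightarrow> bounded_clinear A \<and> surj A \<and> (\<forall>x y. cinner (A x) (A y) = cinner x y)"

definition positive_op :: "('h::complex_hilbert_space \<Rightarrow> 'h) \<Rightarrow> bool" where
  "positive_op A \<longleftrightarrow> bounded_clinear A \<and> (\<forall>x. cinner x (A x) \<in> \<real>\<^sub>\<ge>\<^sub>0)"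

text \<open>An orthonormal basis in the Hilbert space sense: a maximal orthonormal set.\<close>

definition is_onb :: "'h::complex_hilbert_space set \<Rightarrow> bool" where
  "is_onb B \<longleftrightarrow>
     (\<forall>e\<in>B. norm e = 1) \<and>
     (\<forall>e\<in>B. \<forall>f\<in>B. e \<noteq> f \<longrightarrow> cinner e f = 0) \<and>
     (\<forall>x. (\<forall>e\<in>B. cinner e x = 0) \<longrightarrow> x = 0)"

definition some_onb :: "'h::complex_hilbert_space set" where
  "some_onb = (SOME B. is_onb B)"

text \<open>The trace-class operators are the linear span of the positive operators of finite trace;
  each of them is a combination of four such operators. Neither this set nor the trace depends on
  the chosen basis. In finite dimension every linear operator is trace class.\<close>

definition positive_finite_trace :: "('h::complex_hilbert_space \<Rightarrow> 'h) \<Rightarrow> bool" where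
  "positive_finite_trace P \<longleftrightarrow>
     positive_op P \<and> (\<lambda>e. cinner e (P e)) summable_on some_onb"

definition trace_class :: "('h::complex_hilbert_space \<Rightarrow> 'h) \<Rightarrow> bool" where
  "trace_class T \<longleftrightarrow>
     (\<exists>P\<^sub>1 P\<^sub>2 P\<^sub>3 P\<^sub>4.
        positive_finite_trace P\<^sub>1 \<and> positive_finite_trace P\<^sub>2 \<and>
        positive_finite_trace P\<^sub>3 \<and> positive_finite_trace P\<^sub>4 \<and>
        T = (\<lambda>x. (P\<^sub>1 x - P\<^sub>2 x) + \<i> *\<^sub>C (P\<^sub>3 x - P\<^sub>4 x)))"

definition op_trace :: "('h::complex_hilbert_space \<Rightarrow> 'h) \<Rightarrow> complex" where
  "op_trace T = (\<Sum>\<^sub>\<infinity>e\<in>some_onb. cinner e (T e))"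

definition pure_state :: "'h::complex_hilbert_space \<Rightarrow> 'h \<Rightarrow> 'h" where
  "pure_state \<psi> = (\<lambda>x. cinner \<psi> x *\<^sub>C \<psi>)"

section \<open>Quantum channels\<close>

text \<open>Channels act on the trace-class operators; their values elsewhere are irrelevant.\<close>

definition linear_on_trace_class ::
    "(('h::complex_hilbert_space \<Rightarrow> 'h) \<Rightarrow> ('h \<Rightarrow> 'h)) \<Rightarrow> bool" where
  "linear_on_trace_class \<E> \<longleftrightarrow>
     (\<forall>X Y. trace_class X \<longrightarrow> trace_class Y \<longrightarrow>
        \<E> (\<lambda>x. X x + Y x) = (\<lambda>x. \<E> X x + \<E> Y x)) \<and>
     (\<forall>c X. trace_class X \<longrightarrow> \<E> (\<lambda>x. c *\<^sub>C X x) = (\<lambda>x. c *\<^sub>C \<E> X x))"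

definition trace_preserving ::
    "(('h::complex_hilbert_space \<Rightarrow> 'h) \<Rightarrow> ('h \<Rightarrow> 'h)) \<Rightarrow> bool" where
  "trace_preserving \<E> \<longleftrightarrow> (\<forall>X. trace_class X \<longrightarrow> op_trace (\<E> X) = op_trace X)"

text \<open>An operator on the direct sum of \<open>n\<close> copies of the space (equivalently, on the tensor product
  of an \<open>n\<close>-dimensional space with it) is given by its matrix of blocks \<open>X i j\<close>, \<open>i, j < n\<close>.\<close>

definition block_positive ::
    "nat \<Rightarrow> (nat \<Rightarrow> nat \<Rightarrow> ('h::complex_hilbert_space \<Rightarrow> 'h)) \<Rightarrow> bool" where
  "block_positive n X \<longleftrightarrow>
     (\<forall>v :: nat \<Rightarrow> 'h. (\<Sum>i<n. \<Sum>j<n. cinner (v i) (X i j (v j))) \<in> \<real>\<^sub>\<ge>\<^sub>0)"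

text \<open>For every \<open>n\<close>, the identity on \<open>n \<times> n\<close> matrices tensored with \<open>\<E>\<close> preserves positivity.\<close>

definition completely_positive ::
    "(('h::complex_hilbert_space \<Rightarrow> 'h) \<Rightarrow> ('h \<Rightarrow> 'h)) \<Rightarrow> bool" where
  "completely_positive \<E> \<longleftrightarrow>
     (\<forall>n X. (\<forall>i<n. \<forall>j<n. trace_class (X i j)) \<longrightarrow> block_positive n X \<longrightarrow>
        block_positive n (\<lambda>i j. \<E> (X i j)))"

definition quantum_channel ::
    "(('h::complex_hilbert_space \<Rightarrow> 'h) \<Rightarrow> ('h \<Rightarrow> 'h)) \<Rightarrow> bool" where
  "quantum_channel \<E> \<longleftrightarrow>
     (\<forall>X. trace_class X \<longrightarrow> trace_class (\<E> X)) \<and>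
     linear_on_trace_class \<E> \<and> trace_preserving \<E> \<and> completely_positive \<E>"

section \<open>Symmetry\<close>

definition unitary_rep ::
    "('g, 'm) monoid_scheme \<Rightarrow> ('g \<Rightarrow> 'h::complex_hilbert_space \<Rightarrow> 'h) \<Rightarrow> bool" where
  "unitary_rep G U \<longleftrightarrow>
     (\<forall>g\<in>carrier G. unitary_op (U g)) \<and>
     (\<forall>g\<in>carrier G. \<forall>h\<in>carrier G. U (g \<otimes>\<^bsub>G\<^esub> h) = U g \<circ> U h)"

definition char_fun :: "('g \<Rightarrow> 'h::complex_hilbert_space \<Rightarrow> 'h) \<Rightarrow> 'h \<Rightarrow> 'g \<Rightarrow> complex" where
  "char_fun U \<psi> g = cinner \<psi> (U g \<psi>)"

definition covariant ::
    "('g, 'm) monoid_scheme \<Rightarrow> ('g \<Rightarrow> 'h::complex_hilbert_space \<Rightarrow> 'h) \<Rightarrow>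
     (('h \<Rightarrow> 'h) \<Rightarrow> ('h \<Rightarrow> 'h)) \<Rightarrow> bool" where
  "covariant G U \<E> \<longleftrightarrow>
     (\<forall>g\<in>carrier G. \<forall>X. trace_class X \<longrightarrow>
        \<E> (U g \<circ> X \<circ> cadjoint (U g)) = U g \<circ> \<E> X \<circ> cadjoint (U g))"

definition cov_convertible ::
    "('g, 'm) monoid_scheme \<Rightarrow> ('g \<Rightarrow> 'h::complex_hilbert_space \<Rightarrow> 'h) \<Rightarrow>
     ('h \<Rightarrow> 'h) \<Rightarrow> ('h \<Rightarrow> 'h) \<Rightarrow> bool" where
  "cov_convertible G U \<rho> \<sigma> \<longleftrightarrow>
     (\<exists>\<E>. quantum_channel \<E> \<and> covariant G U \<E> \<and> \<E> \<rho> = \<sigma>)"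

definition G_equivalent ::
    "('g, 'm) monoid_scheme \<Rightarrow> ('g \<Rightarrow> 'h::complex_hilbert_space \<Rightarrow> 'h) \<Rightarrow>
     ('h \<Rightarrow> 'h) \<Rightarrow> ('h \<Rightarrow> 'h) \<Rightarrow> bool" where
  "G_equivalent G U \<rho> \<sigma> \<longleftrightarrow> cov_convertible G U \<rho> \<sigma> \<and> cov_convertible G U \<sigma> \<rho>"

end

(* Both directions run through f = chi_psi / chi_phi.

   Necessity: complete positivity applied to the block matrix |U(g_i) psi><U(g_j) psi| gives a positive
   block matrix whose diagonal blocks |U(g_i) phi><U(g_i) phi| have rank one by covariance, so every
   block is f_ij |U(g_i) phi><U(g_j) phi|; taking traces, f_ij = f(g_j^-1 g_i) is positive definite.
   The same holds for 1/f, so |f| = 1, and a unimodular positive definite function with f(1) = 1 is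
   multiplicative because a 3 x 3 Gram matrix with a unimodular entry has a null vector.

   Sufficiency: the orbits g |-> U(g) psi and g |-> exp(i Theta(g)) U(g) phi have the same Gram matrix,
   so there is a partial isometry K from the span of the first onto that of the second; with P the
   projection on its (finite-dimensional) domain, X |-> K X K* + (1-P) X (1-P) is the required channel.
   As P has finite rank, trace preservation needs only the traces of rank-one operators. *)

theory Submission
  imports Defs
begin

section \<open>Complex inner products\<close>

text \<open>Covariance fixes the images of the operators |U(g) psi><U(g) psi| but does not determine
  those of |U(g) psi><U(h) psi|, and the ratio of characteristic functions sits in the latter.
  Complete positivity supplies the link: a vector with zero expectation in a diagonal block is
  annihilated along its whole row and column. This is read off from block positivity itself, so it
  works in every dimension. The scalar that remains in a block is found from tr |a><b| = <b|a>, and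
  it is a quotient because chi_phi has no zero. For the converse, the isometry K satisfies K U(g) =
  exp(i Theta(g)) U(g) K instead of commuting with U(g); the phase disappears from the channel
  because the adjoint of K contributes its conjugate. In general K has no unitary extension with
  this property: the representations on the two complements can fail to match. Hence the complement
  of the domain gets its own term, built from 1 - P, which does commute with every U(g).\<close>

lemma cinner_add_left: "cinner (x + y) z = cinner x z + cinner y z"
  for x :: "'h::complex_hilbert_space"
  by (metis cinner_add_right cinner_commute complex_cnj_add)

lemma cinner_scaleC_left: "cinner (c *\<^sub>C x) y = cnj c * cinner x y"
  for x :: "'h::complex_hilbert_space"
  by (metis cinner_commute cinner_scaleC_right complex_cnj_mult)

lemma cinner_zero_right [simp]: "cinner x 0 = 0"
  for x :: "'h::complex_hilbert_space"
  using cinner_add_right[of x 0 0] by simp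

lemma cinner_zero_left [simp]: "cinner 0 x = 0"
  for x :: "'h::complex_hilbert_space"
  using cinner_add_left[of 0 0 x] by simp

lemma scaleC_one [simp]: "1 *\<^sub>C x = x" for x :: "'h::complex_hilbert_space"
  using scaleC_of_real[of 1 x] by simp

lemma scaleC_zero_left [simp]: "0 *\<^sub>C x = 0" for x :: "'h::complex_hilbert_space"
  using scaleC_of_real[of 0 x] by simp

lemma scaleC_zero_right [simp]: "c *\<^sub>C 0 = (0 :: 'h::complex_hilbert_space)"
  using scaleC_add_right[of c "0::'h" 0] by simp

lemma scaleC_minus_right: "c *\<^sub>C (- x) = - (c *\<^sub>C x)" for x :: "'h::complex_hilbert_space"
  using scaleC_add_right[of c x "-x"] by (simp add: eq_neg_iff_add_eq_0 add.commute)

lemma scaleC_diff_right: "c *\<^sub>C (x - y) = c *\<^sub>C x - c *\<^sub>C y"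
  for x :: "'h::complex_hilbert_space"
  by (metis add_uminus_conv_diff scaleC_add_right scaleC_minus_right)

lemma cinner_minus_right: "cinner x (- y) = - cinner x y"
  for x :: "'h::complex_hilbert_space"
  using cinner_add_right[of x y "-y"] by (simp add: eq_neg_iff_add_eq_0 add.commute)

lemma cinner_minus_left: "cinner (- x) y = - cinner x y"
  for x :: "'h::complex_hilbert_space"
  by (metis cinner_commute cinner_minus_right complex_cnj_minus)

lemma cinner_diff_right: "cinner x (y - z) = cinner x y - cinner x z"
  for x :: "'h::complex_hilbert_space"
  using cinner_add_right[of x y "-z"] by (simp add: cinner_minus_right)

lemma cinner_diff_left: "cinner (x - y) z = cinner x z - cinner y z"
  for x :: "'h::complex_hilbert_space"
  using cinner_add_left[of x "-y" z] by (simp add: cinner_minus_left)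

lemma cinner_sum_right: "cinner x (sum f I) = (\<Sum>i\<in>I. cinner x (f i))"
  for x :: "'h::complex_hilbert_space"
  by (induction I rule: infinite_finite_induct) (auto simp: cinner_add_right)

lemma cinner_sum_left: "cinner (sum f I) x = (\<Sum>i\<in>I. cinner (f i) x)"
  for x :: "'h::complex_hilbert_space"
  by (induction I rule: infinite_finite_induct) (auto simp: cinner_add_left)

lemma scaleC_sum_right: "c *\<^sub>C sum f I = (\<Sum>i\<in>I. c *\<^sub>C (f i :: 'h::complex_hilbert_space))"
  by (induction I rule: infinite_finite_induct) (auto simp: scaleC_add_right)

lemma cinner_self: "cinner x x = complex_of_real ((norm x)\<^sup>2)"
  for x :: "'h::complex_hilbert_space"
proof -
  have "Im (cinner x x) = 0"
    using cinner_commute[of x x] by (simp add: complex_eq_iff)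
  thus ?thesis
    by (simp add: complex_eq_iff inner_eq_Re_cinner[symmetric] power2_norm_eq_inner)
qed

lemma cinner_self_eq_0_iff [simp]: "cinner x x = 0 \<longleftrightarrow> x = 0"
  for x :: "'h::complex_hilbert_space"
  by (simp add: cinner_self)

lemma cinner_ext:
  fixes x y :: "'h::complex_hilbert_space"
  assumes "\<And>u. cinner u x = cinner u y"
  shows "x = y"
  using assms[of "x - y"] cinner_self_eq_0_iff[of "x - y"] by (simp add: cinner_diff_right)

lemma norm_scaleC: "norm (c *\<^sub>C x) = cmod c * norm x"
  for x :: "'h::complex_hilbert_space"
proof -
  have "complex_of_real ((norm (c *\<^sub>C x))\<^sup>2) = c * cnj c * cinner x x"
    unfolding cinner_self[symmetric] by (simp add: cinner_scaleC_left cinner_scaleC_right)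
  also have "\<dots> = complex_of_real ((cmod c * norm x)\<^sup>2)"
    unfolding cinner_self power_mult_distrib of_real_mult complex_norm_square[of c] ..
  finally show ?thesis
    by (simp only: of_real_eq_iff) (simp add: power2_eq_iff_nonneg)
qed

text \<open>The real Cauchy-Schwarz inequality controls only the real part. Rotating
  \<open>y\<close> by the unimodular \<open>u\<close> makes the inner product real and nonnegative
  and leaves the norm of \<open>y\<close> alone.\<close>

lemma cmod_cinner_le: "cmod (cinner x y) \<le> norm x * norm y"
  for x y :: "'h::complex_hilbert_space"
proof (cases "cinner x y = 0")
  case False
  define u where "u = cnj (sgn (cinner x y))"
  have u: "cmod u = 1" using False by (simp add: u_def norm_sgn)
  have "u * cinner x y = complex_of_real (cmod (cinner x y))"
    using False complex_norm_square[of "cinner x y"]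
    by (simp add: u_def sgn_eq field_simps power2_eq_square)
  hence "cmod (cinner x y) = inner x (u *\<^sub>C y)"
    by (simp add: inner_eq_Re_cinner cinner_scaleC_right)
  also have "\<dots> \<le> norm x * norm (u *\<^sub>C y)" by (rule norm_cauchy_schwarz)
  finally show ?thesis by (simp add: norm_scaleC u)
qed simp

lemma bounded_linear_cinner_right: "bounded_linear (cinner x)"
  for x :: "'h::complex_hilbert_space"
proof (rule bounded_linear_intro)
  fix r y show "cinner x (r *\<^sub>R y) = r *\<^sub>R cinner x y"
    by (simp add: cinner_scaleC_right scaleR_conv_of_real flip: scaleC_of_real)
  show "norm (cinner x y) \<le> norm y * norm x"
    using cmod_cinner_le[of x y] by (simp add: mult.commute)
qed (rule cinner_add_right)

lemma bounded_linear_scaleC_right: "bounded_linear (\<lambda>x :: 'h::complex_hilbert_space. c *\<^sub>C x)"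
proof (rule bounded_linear_intro)
  fix r and y :: 'h show "c *\<^sub>C r *\<^sub>R y = r *\<^sub>R c *\<^sub>C y"
    by (simp add: scaleC_scaleC mult.commute flip: scaleC_of_real)
  show "norm (c *\<^sub>C y) \<le> norm y * cmod c"
    by (simp add: norm_scaleC mult.commute)
qed (rule scaleC_add_right)

lemma bounded_linear_scaleC_left: "bounded_linear (\<lambda>c. c *\<^sub>C (x :: 'h::complex_hilbert_space))"
proof (rule bounded_linear_intro)
  fix r c show "(r *\<^sub>R c) *\<^sub>C x = r *\<^sub>R c *\<^sub>C x"
    by (simp add: scaleC_scaleC scaleR_conv_of_real flip: scaleC_of_real)
  show "norm (c *\<^sub>C x) \<le> norm c * norm x" by (simp add: norm_scaleC)
qed (rule scaleC_add_left)

section \<open>Bounded complex-linear operators and rank-one operators\<close>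

lemma bounded_clinearD:
  assumes "bounded_clinear A"
  shows "A (x + y) = A x + A y" "A (x - y) = A x - A y" "A (c *\<^sub>C x) = c *\<^sub>C A x"
    "A (sum f I) = (\<Sum>i\<in>I. A (f i))" "A 0 = 0"
proof -
  interpret bounded_linear A using assms by (simp add: bounded_clinear_def)
  show "A (x + y) = A x + A y" "A (x - y) = A x - A y" "A (sum f I) = (\<Sum>i\<in>I. A (f i))" "A 0 = 0"
    by (fact add diff sum zero)+
  show "A (c *\<^sub>C x) = c *\<^sub>C A x" using assms by (simp add: bounded_clinear_def)
qed

lemma bounded_clinear_add:
  "bounded_clinear A \<Longrightarrow> bounded_clinear B \<Longrightarrow> bounded_clinear (\<lambda>x. A x + B x)"
  by (auto simp: bounded_clinear_def scaleC_add_right intro: bounded_linear_add)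

lemma bounded_clinear_diff:
  "bounded_clinear A \<Longrightarrow> bounded_clinear B \<Longrightarrow> bounded_clinear (\<lambda>x. A x - B x)"
  by (auto simp: bounded_clinear_def scaleC_diff_right intro: bounded_linear_sub)

lemma bounded_clinear_scaleC:
  "bounded_clinear A \<Longrightarrow> bounded_clinear (\<lambda>x. c *\<^sub>C A x)"
  by (auto simp: bounded_clinear_def scaleC_scaleC mult.commute
      intro: bounded_linear_compose[OF bounded_linear_scaleC_right])

lemma bounded_clinear_compose:
  "bounded_clinear A \<Longrightarrow> bounded_clinear B \<Longrightarrow> bounded_clinear (\<lambda>x. A (B x))"
  by (auto simp: bounded_clinear_def intro: bounded_linear_compose)

lemma bounded_clinear_ident: "bounded_clinear (\<lambda>x. x)"
  by (simp add: bounded_clinear_def)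

lemma bounded_clinear_sum:
  "(\<And>i. i \<in> I \<Longrightarrow> bounded_clinear (A i)) \<Longrightarrow> bounded_clinear (\<lambda>x. \<Sum>i\<in>I. A i x)"
  by (auto simp: bounded_clinear_def scaleC_sum_right intro: bounded_linear_sum)

definition ketbra :: "'h::complex_hilbert_space \<Rightarrow> 'h \<Rightarrow> 'h \<Rightarrow> 'h" where
  "ketbra a b = (\<lambda>x. cinner b x *\<^sub>C a)"

lemma bounded_clinear_ketbra: "bounded_clinear (ketbra a b)"
  unfolding bounded_clinear_def ketbra_def
  by (intro conjI bounded_linear_compose[OF bounded_linear_scaleC_left bounded_linear_cinner_right])
     (simp add: cinner_scaleC_right scaleC_scaleC)

lemma pure_state_eq_ketbra: "pure_state a = ketbra a a"
  by (simp add: pure_state_def ketbra_def)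

section \<open>Orthonormal bases\<close>

definition orthonormal :: "'h::complex_hilbert_space set \<Rightarrow> bool" where
  "orthonormal B \<longleftrightarrow> (\<forall>e\<in>B. \<forall>f\<in>B. cinner e f = (if e = f then 1 else 0))"

lemma cinner_self_eq_1_iff: "cinner x x = 1 \<longleftrightarrow> norm x = 1"
  for x :: "'h::complex_hilbert_space"
proof -
  have "cinner x x = 1 \<longleftrightarrow> (norm x)\<^sup>2 = 1"
    unfolding cinner_self by (rule of_real_eq_1_iff)
  also have "\<dots> \<longleftrightarrow> norm x = 1"
    unfolding power2_eq_1_iff using norm_ge_zero[of x] by linarith
  finally show ?thesis .
qed

lemma orthonormal_iff:
  "orthonormal B \<longleftrightarrow> (\<forall>e\<in>B. norm e = 1) \<and> (\<forall>e\<in>B. \<forall>f\<in>B. e \<noteq> f \<longrightarrow> cinner e f = 0)"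
  unfolding orthonormal_def cinner_self_eq_1_iff[symmetric] by auto

lemma orthonormal_sum_right:
  assumes "orthonormal B" "F \<subseteq> B" "finite F" "e \<in> B"
  shows "cinner e (\<Sum>f\<in>F. c f *\<^sub>C f) = (if e \<in> F then c e else 0)"
proof -
  have "cinner e (\<Sum>f\<in>F. c f *\<^sub>C f) = (\<Sum>f\<in>F. if e = f then c f else 0)"
    unfolding cinner_sum_right cinner_scaleC_right
    using assms by (intro sum.cong) (auto simp: orthonormal_def)
  thus ?thesis using assms(3) by simp
qed

lemma norm_orthonormal_sum:
  assumes "orthonormal F" "finite F"
  shows "(norm (\<Sum>f\<in>F. c f *\<^sub>C f))\<^sup>2 = (\<Sum>f\<in>F. (cmod (c f))\<^sup>2)"
proof -
  have "complex_of_real ((norm (\<Sum>f\<in>F. c f *\<^sub>C f))\<^sup>2) = (\<Sum>f\<in>F. cnj (c f) * c f)"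
    unfolding cinner_self[symmetric] cinner_sum_left
    using assms by (auto simp: cinner_scaleC_left orthonormal_sum_right intro!: sum.cong)
  also have "\<dots> = complex_of_real (\<Sum>f\<in>F. (cmod (c f))\<^sup>2)"
    unfolding of_real_sum complex_norm_square by (simp add: mult.commute)
  finally show ?thesis by (simp only: of_real_eq_iff)
qed

lemma bessel:
  assumes "orthonormal F" "finite F"
  shows "(\<Sum>e\<in>F. (cmod (cinner e x))\<^sup>2) \<le> (norm x)\<^sup>2"
proof -
  define p where "p = (\<Sum>e\<in>F. cinner e x *\<^sub>C e)"
  have "cinner e (x - p) = 0" if "e \<in> F" for e
    using that assms by (simp add: p_def cinner_diff_right orthonormal_sum_right)
  hence "cinner p (x - p) = 0"
    by (simp add: p_def cinner_sum_left cinner_scaleC_left)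
  hence "inner p (x - p) = 0" by (simp add: inner_eq_Re_cinner)
  hence "(norm (p + (x - p)))\<^sup>2 = (norm p)\<^sup>2 + (norm (x - p))\<^sup>2"
    by (simp only: power2_norm_eq_inner inner_add_left inner_add_right inner_commute[of "x - p" p])
  hence "(norm p)\<^sup>2 \<le> (norm x)\<^sup>2" by simp
  thus ?thesis using assms by (simp add: p_def norm_orthonormal_sum)
qed

text \<open>\<open>some_onb\<close> is a choice, so every statement on traces rests on this witness.
  Zorn's lemma applies because two vectors from the union of a chain lie in a common member; a
  nonzero vector orthogonal to a maximal set could be normalised and added to it.\<close>

lemma ex_is_onb: "\<exists>B :: 'h::complex_hilbert_space set. is_onb B"
proof -
  have "\<exists>M\<in>Collect orthonormal. \<forall>X\<in>Collect (orthonormal :: 'h set \<Rightarrow> bool). M \<subseteq> X \<longrightarrow> X = M"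
  proof (rule subset_Zorn', safe)
    fix C :: "'h set set" assume C: "subset.chain (Collect orthonormal) C"
    show "orthonormal (\<Union>C)"
      unfolding orthonormal_def
    proof safe
      fix e f E F assume "e \<in> E" "E \<in> C" "f \<in> F" "F \<in> C"
      moreover from this C have "E \<subseteq> F \<or> F \<subseteq> E" "orthonormal E" "orthonormal F"
        by (auto simp: subset_chain_def)
      ultimately show "cinner e f = (if e = f then 1 else 0)"
        by (auto simp: orthonormal_def subset_iff)
    qed
  qed
  then obtain M :: "'h set" where M: "orthonormal M" "\<And>X. orthonormal X \<Longrightarrow> M \<subseteq> X \<Longrightarrow> X = M"
    by auto
  have "x = 0" if x: "\<forall>e\<in>M. cinner e x = 0" for x
  proof (rule ccontr)
    assume "x \<noteq> 0"
    define u where "u = complex_of_real (inverse (norm x)) *\<^sub>C x"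
    have u: "cinner u u = 1"
      using \<open>x \<noteq> 0\<close> by (simp add: cinner_self_eq_1_iff u_def norm_scaleC norm_inverse)
    have "cinner e u = 0" "cinner u e = 0" if "e \<in> M" for e
      using x that cinner_commute[of x e]
      by (auto simp: u_def cinner_scaleC_right cinner_scaleC_left)
    with u M(1) have "orthonormal (insert u M)"
      by (auto simp: orthonormal_def)
    hence "u \<in> M" using M(2) by blast
    with u \<open>\<And>e. e \<in> M \<Longrightarrow> cinner e u = 0\<close> show False by fastforce
  qed
  with M(1) have "is_onb M" by (auto simp: is_onb_def orthonormal_iff)
  thus ?thesis ..
qed

lemma is_onb_some_onb: "is_onb some_onb"
  unfolding some_onb_def by (rule someI_ex[OF ex_is_onb])

text \<open>\<open>is_onb\<close> asserts only maximality, and the basis may be uncountable, so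
  convergence has to come from completeness. Bessel makes the squared coefficients summable, hence
  the net of finite partial sums is Cauchy. Its limit has the same coefficients as \<open>x\<close>,
  and maximality identifies the two.\<close>

lemma fourier_expansion:
  assumes "is_onb B"
  shows "((\<lambda>e. cinner e x *\<^sub>C e) has_sum x) B"
proof -
  have on: "orthonormal B" and max: "\<And>y. (\<forall>e\<in>B. cinner e y = 0) \<Longrightarrow> y = 0"
    using assms by (auto simp: is_onb_def orthonormal_iff)
  have onF: "orthonormal F" if "F \<subseteq> B" for F using on that unfolding orthonormal_def by blast
  define f where "f = (\<lambda>e. cinner e x *\<^sub>C e)"
  define q where "q = (\<lambda>e. (cmod (cinner e x))\<^sup>2)"
  have "q summable_on B"
  proof (rule nonneg_bdd_above_summable_on)
    show "bdd_above (sum q ` {F. F \<subseteq> B \<and> finite F})"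
      by (auto intro!: bdd_aboveI[of _ "(norm x)\<^sup>2"] simp: q_def bessel onF)
  qed (simp add: q_def)
  then obtain s where "(q has_sum s) B" by (auto simp: summable_on_def)
  hence "cauchy_filter (filtermap (sum q) (finite_subsets_at_top B))"
    by (auto intro!: nhds_imp_cauchy_filter simp: filterlim_def has_sum_def)
  hence cq: "\<And>e. e > 0 \<Longrightarrow> \<exists>P. eventually P (finite_subsets_at_top B) \<and>
      (\<forall>F F'. P F \<and> P F' \<longrightarrow> dist (sum q F) (sum q F') < e)"
    by (simp add: cauchy_filter_metric_filtermap)
  have "cauchy_filter (filtermap (sum f) (finite_subsets_at_top B))"
    unfolding cauchy_filter_metric_filtermap
  proof (intro allI impI)
    fix e :: real assume "e > 0"
    hence "(e/2)\<^sup>2 > 0" by simp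
    from cq[OF this] obtain P where P: "eventually P (finite_subsets_at_top B)"
      "\<And>F F'. P F \<Longrightarrow> P F' \<Longrightarrow> dist (sum q F) (sum q F') < (e/2)\<^sup>2" by blast
    then obtain F0 where F0: "finite F0" "F0 \<subseteq> B"
      "\<And>F. finite F \<Longrightarrow> F0 \<subseteq> F \<Longrightarrow> F \<subseteq> B \<Longrightarrow> P F"
      by (auto simp: eventually_finite_subsets_at_top)
    \<comment> \<open>Only for nested index sets is the difference of partial sums again an
      orthonormal sum, with squared norm a difference of sums of \<open>q\<close>. So everything is
      compared with \<open>F0\<close>, and two arbitrary sets meet there at the cost of
      \<open>e/2\<close> each.\<close>
    have near: "dist (sum f F) (sum f F0) < e/2" if "finite F" "F0 \<subseteq> F" "F \<subseteq> B" for F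
    proof -
      have fd: "sum f F - sum f F0 = sum f (F - F0)" and qd: "sum q F - sum q F0 = sum q (F - F0)"
        using that by (simp_all add: sum_diff)
      have "orthonormal (F - F0)" "finite (F - F0)"
        using that by (blast intro: onF, simp)
      hence "(dist (sum f F) (sum f F0))\<^sup>2 = sum q (F - F0)"
        unfolding dist_norm fd unfolding f_def q_def by (rule norm_orthonormal_sum)
      also have "\<dots> < (e/2)\<^sup>2"
        using P(2)[of F F0] F0 that unfolding qd[symmetric] by (simp add: dist_real_def)
      finally have lt: "(dist (sum f F) (sum f F0))\<^sup>2 < (e/2)\<^sup>2" .
      have "0 \<le> e/2" using \<open>e > 0\<close> by linarith
      with lt show ?thesis by (rule power2_less_imp_less)
    qed
    have "eventually (\<lambda>F. finite F \<and> F0 \<subseteq> F \<and> F \<subseteq> B) (finite_subsets_at_top B)"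
      using F0 by (auto simp: eventually_finite_subsets_at_top)
    moreover have "dist (sum f F) (sum f F') < e"
      if "finite F \<and> F0 \<subseteq> F \<and> F \<subseteq> B" "finite F' \<and> F0 \<subseteq> F' \<and> F' \<subseteq> B" for F F'
      using near[of F] near[of F'] that dist_triangle2[of "sum f F" "sum f F'" "sum f F0"] by linarith
    ultimately show "\<exists>P. eventually P (finite_subsets_at_top B) \<and>
        (\<forall>F F'. P F \<and> P F' \<longrightarrow> dist (sum f F) (sum f F') < e)"
      by (intro exI[of _ "\<lambda>F. finite F \<and> F0 \<subseteq> F \<and> F \<subseteq> B"] conjI allI impI) simp_all
  qed
  hence "convergent_filter (filtermap (sum f) (finite_subsets_at_top B))"
    by (rule cauchy_filter_convergent)
  then obtain y where y: "(f has_sum y) B"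
    by (auto simp: convergent_filter_iff has_sum_def filterlim_def)
  have "cinner e (x - y) = 0" if "e \<in> B" for e
  proof -
    have "((\<lambda>i. cinner e (f i)) has_sum cinner e y) B"
      by (rule has_sum_bounded_linear[OF bounded_linear_cinner_right y])
    moreover have "((\<lambda>i. cinner e (f i)) has_sum cinner e x) B"
    proof (rule has_sum_finite_neutralI)
      show "finite {e}" "{e} \<subseteq> B" using that by auto
      have "cinner e e = 1" using on that by (simp add: orthonormal_def)
      thus "cinner e x = (\<Sum>i\<in>{e}. cinner e (f i))" by (simp add: f_def cinner_scaleC_right)
      fix i assume "i \<in> B - {e}"
      hence "cinner e i = 0" using on that unfolding orthonormal_def by auto
      thus "cinner e (f i) = 0" by (simp add: f_def cinner_scaleC_right)
    qed
    ultimately show ?thesis by (simp add: cinner_diff_right has_sum_unique)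
  qed
  hence "x = y" using max[of "x - y"] by simp
  with y show ?thesis by (simp add: f_def)
qed

text \<open>The summands are the diagonal entries of |a><b|, so this gives both the summability and
  the value of every rank-one trace, whichever basis was chosen.\<close>

lemma parseval:
  assumes "is_onb B"
  shows "((\<lambda>e. cinner b e * cinner e a) has_sum cinner b a) B"
  using has_sum_bounded_linear[OF bounded_linear_cinner_right[of b] fourier_expansion[OF assms, of a]]
  by (simp add: cinner_scaleC_right mult.commute)

section \<open>Trace-class operators\<close>

text \<open>Three values suffice: \<open>t = 0\<close> shows that \<open>a\<close> is real,
  \<open>t = 1\<close> that the imaginary parts of \<open>b\<close> and \<open>c\<close> are
  opposite, and \<open>t = \<i>\<close> that their real parts agree.\<close>

lemma hermitian_pair:
  fixes a b c d :: complex
  assumes "\<And>t. a + t * b + cnj t * c + t * cnj t * d \<in> \<real>" and "d \<in> \<real>"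
  shows "c = cnj b"
  using assms(1)[of 0] assms(1)[of 1] assms(1)[of \<i>] assms(2)
  by (auto simp: complex_is_Real_iff complex_eq_iff)

text \<open>Once \<open>c\<close> is the conjugate of \<open>b\<close>, the expression is a + 2 Re(t
  b), which is unbounded below unless \<open>b\<close> vanishes.\<close>

lemma nonneg_affine_imp_zero:
  fixes a b c :: complex
  assumes "\<And>t. a + t * b + cnj t * c \<in> \<real>\<^sub>\<ge>\<^sub>0"
  shows "b = 0" "c = 0"
proof -
  have c: "c = cnj b"
    by (rule hermitian_pair[where a = a and d = 0])
       (use assms nonneg_Reals_subset_Reals in auto)
  \<comment> \<open>For nonzero \<open>b\<close>, this length in the direction
    \<open>- cnj b\<close> brings the expression down to exactly -1.\<close>
  define s where "s = (Re a + 1) / (2 * (cmod b)\<^sup>2)"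
  define t where "t = - complex_of_real s * cnj b"
  have "t * b = - complex_of_real (s * (cmod b)\<^sup>2)"
    by (simp add: t_def complex_norm_square mult.commute del: of_real_power)
  moreover from arg_cong[OF this, of cnj] have "cnj t * c = - complex_of_real (s * (cmod b)\<^sup>2)"
    by (simp add: c)
  ultimately have "0 \<le> Re a - 2 * (s * (cmod b)\<^sup>2)"
    using assms[of t] by (simp add: complex_nonneg_Reals_iff del: of_real_mult of_real_power)
  hence "b = 0" by (cases "b = 0") (simp_all add: s_def)
  thus "b = 0" "c = 0" using c by simp_all
qed

text \<open>Polarisation: the form at \<open>x + t *\<^sub>C y\<close> is real for every
  \<open>t\<close>, which forces the two mixed terms to be conjugate.\<close>

lemma positive_op_hermitian:
  assumes "positive_op X"
  shows "cinner (X x) y = cinner x (X y)"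
proof -
  have lin: "bounded_clinear X" and pos: "\<And>x. cinner x (X x) \<in> \<real>"
    using assms nonneg_Reals_subset_Reals by (auto simp: positive_op_def)
  have "cinner y (X x) = cnj (cinner x (X y))"
  proof (rule hermitian_pair)
    fix t
    show "cinner x (X x) + t * cinner x (X y) + cnj t * cinner y (X x) + t * cnj t * cinner y (X y) \<in> \<real>"
      using pos[of "x + t *\<^sub>C y"]
      by (simp add: bounded_clinearD[OF lin] cinner_add_left cinner_add_right
          cinner_scaleC_left cinner_scaleC_right algebra_simps)
  qed (rule pos)
  thus ?thesis using cinner_commute[of "X x" y] by simp
qed

lemma has_sum_sum:
  fixes f :: "'i \<Rightarrow> 'a \<Rightarrow> complex"
  assumes "\<And>i. i \<in> I \<Longrightarrow> (f i has_sum s i) S"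
  shows "((\<lambda>x. \<Sum>i\<in>I. f i x) has_sum (\<Sum>i\<in>I. s i)) S"
  using assms by (induction I rule: infinite_finite_induct) (auto intro: has_sum_add)

lemma has_sum_trace_ketbra: "((\<lambda>e. cinner b e * cinner e a) has_sum cinner b a) some_onb"
  by (rule parseval[OF is_onb_some_onb])

lemma op_trace_ketbra: "op_trace (ketbra a b) = cinner b a"
  using infsumI[OF has_sum_trace_ketbra[of b a]]
  by (simp add: op_trace_def ketbra_def cinner_scaleC_right)

lemma positive_finite_trace_ketbra: "positive_finite_trace (ketbra a a)"
proof -
  have "cinner x (ketbra a a x) = complex_of_real ((cmod (cinner a x))\<^sup>2)" for x
    unfolding complex_norm_square using cinner_commute[of x a]
    by (simp add: ketbra_def cinner_scaleC_right)
  hence "cinner x (ketbra a a x) \<in> \<real>\<^sub>\<ge>\<^sub>0" for x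
    by (simp add: complex_nonneg_Reals_iff del: of_real_power)
  moreover have "(\<lambda>e. cinner e (ketbra a a e)) summable_on some_onb"
    using has_sum_trace_ketbra[of a a]
    by (auto simp: ketbra_def cinner_scaleC_right summable_on_def)
  ultimately show ?thesis
    by (simp add: positive_finite_trace_def positive_op_def bounded_clinear_ketbra)
qed

text \<open>Polarisation again. Halving the vectors puts the factor 1/4 inside the positive
  operators, so that they occur with just the coefficients 1, -1, \<i>, -\<i> prescribed by
  \<open>trace_class\<close>.\<close>

lemma trace_class_ketbra: "trace_class (ketbra a b)"
proof -
  define h where "h t = ketbra ((1/2) *\<^sub>C (a + t *\<^sub>C b)) ((1/2) *\<^sub>C (a + t *\<^sub>C b))" for t
  have h: "cinner u (h t x) = (1/4) * (cinner a x * cinner u a + t * (cinner a x * cinner u b)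
      + cnj t * (cinner b x * cinner u a) + t * cnj t * (cinner b x * cinner u b))" for t u x
    by (simp add: h_def ketbra_def cinner_add_left cinner_add_right cinner_scaleC_left
        cinner_scaleC_right algebra_simps)
  have "ketbra a b = (\<lambda>x. (h 1 x - h (-1) x) + \<i> *\<^sub>C (h \<i> x - h (-\<i>) x))"
  proof (rule ext, rule cinner_ext)
    fix x u
    show "cinner u (ketbra a b x) = cinner u ((h 1 x - h (-1) x) + \<i> *\<^sub>C (h \<i> x - h (-\<i>) x))"
      by (simp add: cinner_add_right cinner_diff_right cinner_scaleC_right h)
         (simp add: ketbra_def cinner_scaleC_right field_simps)
  qed
  thus ?thesis
    unfolding trace_class_def h_def using positive_finite_trace_ketbra by blast
qed

lemma trace_classE:
  assumes "trace_class T"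
  obtains P1 P2 P3 P4 where "positive_finite_trace P1" "positive_finite_trace P2"
    "positive_finite_trace P3" "positive_finite_trace P4"
    "T = (\<lambda>x. (P1 x - P2 x) + \<i> *\<^sub>C (P3 x - P4 x))"
  using assms unfolding trace_class_def by (elim exE conjE) (rule that)

lemma trace_class_imp_bounded_clinear:
  assumes "trace_class T"
  shows "bounded_clinear T"
  using assms unfolding trace_class_def positive_finite_trace_def positive_op_def
  by (auto intro!: bounded_clinear_add bounded_clinear_diff bounded_clinear_scaleC)

text \<open>An infinite sum may be split only into summable parts; positive operators of finite
  trace provide them.\<close>

lemma op_trace_combination:
  assumes "positive_finite_trace P1" "positive_finite_trace P2"
    "positive_finite_trace P3" "positive_finite_trace P4"
  shows "op_trace (\<lambda>x. (P1 x - P2 x) + \<i> *\<^sub>C (P3 x - P4 x)) =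
    (op_trace P1 - op_trace P2) + \<i> * (op_trace P3 - op_trace P4)"
proof -
  have *: "((\<lambda>e. cinner e (P e)) has_sum op_trace P) some_onb" if "positive_finite_trace P" for P
    using that by (auto simp: positive_finite_trace_def op_trace_def)
  have "((\<lambda>e. (cinner e (P1 e) + (-1) * cinner e (P2 e)) + \<i> * (cinner e (P3 e) + (-1) * cinner e (P4 e)))
      has_sum (op_trace P1 + (-1) * op_trace P2) + \<i> * (op_trace P3 + (-1) * op_trace P4)) some_onb"
    using assms by (intro has_sum_add has_sum_cmult_right *)
  thus ?thesis unfolding op_trace_def[of "\<lambda>x. _ x - _ x + _ x"]
    by (intro infsumI) (simp add: cinner_add_right cinner_diff_right cinner_scaleC_right)
qed

section \<open>Channels from partial isometries\<close>

text \<open>\<open>K'\<close> is meant as the adjoint of \<open>K\<close>, and \<open>Q\<close> as a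
  self-adjoint operator. The adjoint is passed explicitly because \<open>cadjoint\<close> is a
  definite description, meaningful only once an adjoint has been exhibited.\<close>

definition two_kraus ::
    "('h::complex_hilbert_space \<Rightarrow> 'h) \<Rightarrow> ('h \<Rightarrow> 'h) \<Rightarrow> ('h \<Rightarrow> 'h) \<Rightarrow> ('h \<Rightarrow> 'h) \<Rightarrow> 'h \<Rightarrow> 'h" where
  "two_kraus K K' Q X = (\<lambda>x. K (X (K' x)) + Q (X (Q x)))"

definition partial_isometry :: "'h::complex_hilbert_space set \<Rightarrow> ('h \<Rightarrow> 'h) \<Rightarrow> 'h \<Rightarrow> 'h" where
  "partial_isometry A w x = (\<Sum>a\<in>A. cinner a x *\<^sub>C w a)"

definition partial_isometry_adj :: "'h::complex_hilbert_space set \<Rightarrow> ('h \<Rightarrow> 'h) \<Rightarrow> 'h \<Rightarrow> 'h" where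
  "partial_isometry_adj A w x = (\<Sum>a\<in>A. cinner (w a) x *\<^sub>C a)"

abbreviation proj :: "'h::complex_hilbert_space set \<Rightarrow> 'h \<Rightarrow> 'h" where
  "proj A \<equiv> partial_isometry A (\<lambda>a. a)"

lemma bounded_clinear_partial_isometry: "bounded_clinear (partial_isometry A w)"
  using bounded_clinear_sum[of A "\<lambda>a. ketbra (w a) a"] bounded_clinear_ketbra
  unfolding partial_isometry_def[abs_def] ketbra_def by blast

lemma bounded_clinear_partial_isometry_adj: "bounded_clinear (partial_isometry_adj A w)"
  using bounded_clinear_sum[of A "\<lambda>a. ketbra a (w a)"] bounded_clinear_ketbra
  unfolding partial_isometry_adj_def[abs_def] ketbra_def by blast

lemma cinner_partial_isometry:
  "cinner x (partial_isometry A w y) = cinner (partial_isometry_adj A w x) y"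
  unfolding partial_isometry_def partial_isometry_adj_def cinner_sum_left cinner_sum_right
    cinner_scaleC_left cinner_scaleC_right
  by (intro sum.cong refl) (metis cinner_commute mult.commute)

lemma proj_adj: "partial_isometry_adj A (\<lambda>a. a) = proj A"
  by (simp add: partial_isometry_def partial_isometry_adj_def fun_eq_iff)

text \<open>Expansion gives the sum of <a|X b> tr |w a><w b|, and orthonormality keeps the terms
  with a = b. The value does not involve \<open>w\<close>; hence conjugation by the isometry and
  compression by \<open>proj A\<close> yield the same trace.\<close>

lemma has_sum_partial_isometry_conj:
  assumes "bounded_clinear X" "finite A"
    and w: "\<And>a b. a \<in> A \<Longrightarrow> b \<in> A \<Longrightarrow> cinner (w a) (w b) = (if a = b then 1 else 0)"
  shows "((\<lambda>e. cinner e (partial_isometry A w (X (partial_isometry_adj A w e)))) has_sum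
    (\<Sum>a\<in>A. cinner a (X a))) some_onb"
proof -
  have "((\<lambda>e. \<Sum>a\<in>A. \<Sum>b\<in>A. cinner a (X b) * (cinner (w b) e * cinner e (w a))) has_sum
     (\<Sum>a\<in>A. \<Sum>b\<in>A. cinner a (X b) * cinner (w b) (w a))) some_onb"
    by (intro has_sum_sum has_sum_cmult_right has_sum_trace_ketbra)
  moreover have "(\<Sum>a\<in>A. \<Sum>b\<in>A. cinner a (X b) * cinner (w b) (w a)) = (\<Sum>a\<in>A. cinner a (X a))"
  proof (rule sum.cong[OF refl])
    fix a assume "a \<in> A"
    hence "(\<Sum>b\<in>A. cinner a (X b) * cinner (w b) (w a)) = (\<Sum>b\<in>A. if b = a then cinner a (X b) else 0)"
      by (intro sum.cong) (auto simp: w)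
    thus "(\<Sum>b\<in>A. cinner a (X b) * cinner (w b) (w a)) = cinner a (X a)"
      using \<open>a \<in> A\<close> assms(2) by simp
  qed
  ultimately show ?thesis
    unfolding partial_isometry_def partial_isometry_adj_def
    by (simp add: bounded_clinearD[OF assms(1)] cinner_sum_right cinner_scaleC_right
        sum_distrib_left sum_distrib_right mult_ac)
qed

text \<open>With P for \<open>proj A\<close>, the second term is X - PX - XP + PXP. The operators
  PX, XP, PXP and the isometric term all have trace \<open>?S\<close>, so these contributions cancel
  and the trace of \<open>X\<close> remains.\<close>

lemma two_kraus_positive:
  fixes A :: "'h::complex_hilbert_space set"
  defines "\<E> \<equiv> \<lambda>w. two_kraus (partial_isometry A w) (partial_isometry_adj A w) (\<lambda>x. x - proj A x)"
  assumes X: "positive_finite_trace X" and A: "finite A" "orthonormal A"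
    and w: "\<And>a b. a \<in> A \<Longrightarrow> b \<in> A \<Longrightarrow> cinner (w a) (w b) = (if a = b then 1 else 0)"
  shows "positive_finite_trace (\<E> w X)" "op_trace (\<E> w X) = op_trace X"
proof -
  let ?S = "\<Sum>a\<in>A. cinner a (X a)"
  have Xp: "positive_op X" and lin: "bounded_clinear X"
    and tr: "((\<lambda>e. cinner e (X e)) has_sum op_trace X) some_onb"
    using X by (auto simp: positive_finite_trace_def op_trace_def positive_op_def)
  note herm = positive_op_hermitian[OF Xp]
  have 1: "((\<lambda>e. cinner e (partial_isometry A w (X (partial_isometry_adj A w e)))) has_sum ?S) some_onb"
    by (rule has_sum_partial_isometry_conj) (use lin A w in auto)
  have 2: "((\<lambda>e. cinner e (proj A (X (proj A e)))) has_sum ?S) some_onb"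
    using has_sum_partial_isometry_conj[OF lin A(1), of "\<lambda>a. a"] A(2)
    by (simp add: proj_adj orthonormal_def)
  \<comment> \<open>Hermiticity moves \<open>X\<close> onto the fixed vector \<open>a\<close>, which
    turns PX into a finite sum of rank-one operators.\<close>
  have 3: "((\<lambda>e. cinner e (proj A (X e))) has_sum ?S) some_onb"
  proof -
    have "((\<lambda>e. \<Sum>a\<in>A. cinner (X a) e * cinner e a) has_sum (\<Sum>a\<in>A. cinner (X a) a)) some_onb"
      by (intro has_sum_sum has_sum_trace_ketbra)
    thus ?thesis
      by (simp add: partial_isometry_def cinner_sum_right cinner_scaleC_right herm)
  qed
  have 4: "((\<lambda>e. cinner e (X (proj A e))) has_sum ?S) some_onb"
  proof -
    have "((\<lambda>e. \<Sum>a\<in>A. cinner a e * cinner e (X a)) has_sum (\<Sum>a\<in>A. cinner a (X a))) some_onb"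
      by (intro has_sum_sum has_sum_trace_ketbra)
    thus ?thesis
      by (simp add: partial_isometry_def bounded_clinearD[OF lin] cinner_sum_right cinner_scaleC_right)
  qed
  have "((\<lambda>e. cinner e (partial_isometry A w (X (partial_isometry_adj A w e))) +
      (cinner e (X e) + ((-1) * cinner e (proj A (X e)) + ((-1) * cinner e (X (proj A e)) +
        cinner e (proj A (X (proj A e))))))) has_sum
      (?S + (op_trace X + ((-1) * ?S + ((-1) * ?S + ?S))))) some_onb"
    by (intro has_sum_add has_sum_cmult_right 1 2 3 4 tr)
  hence tr': "((\<lambda>e. cinner e (\<E> w X e)) has_sum op_trace X) some_onb"
    unfolding \<E>_def two_kraus_def
    by (simp add: cinner_add_right cinner_diff_right bounded_clinearD[OF lin] algebra_simps
        bounded_clinearD[OF bounded_clinear_partial_isometry])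
  have "bounded_clinear (\<E> w X)"
    unfolding \<E>_def two_kraus_def
    by (intro bounded_clinear_add bounded_clinear_compose[OF bounded_clinear_partial_isometry]
        bounded_clinear_compose[OF lin] bounded_clinear_partial_isometry_adj
        bounded_clinear_compose[OF bounded_clinear_diff] bounded_clinear_diff bounded_clinear_ident
        bounded_clinear_partial_isometry)
  moreover have "cinner x (\<E> w X x) \<in> \<real>\<^sub>\<ge>\<^sub>0" for x
  proof -
    have "cinner x (\<E> w X x) = cinner (partial_isometry_adj A w x) (X (partial_isometry_adj A w x))
       + cinner (x - proj A x) (X (x - proj A x))"
      by (simp add: \<E>_def two_kraus_def cinner_add_right cinner_partial_isometry
          cinner_diff_right cinner_diff_left proj_adj)
    thus ?thesis using Xp by (simp add: positive_op_def nonneg_Reals_add_I)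
  qed
  ultimately show "positive_finite_trace (\<E> w X)"
    using tr' by (auto simp: positive_finite_trace_def positive_op_def summable_on_def)
  show "op_trace (\<E> w X) = op_trace X"
    using infsumI[OF tr'] by (simp add: op_trace_def)
qed

text \<open>Trace-class operators are reached through their four positive parts. Complete positivity
  holds because each of the two terms merely replaces the test vectors \<open>v i\<close> by their
  images under \<open>?K'\<close> or \<open>?Q\<close>.\<close>

lemma quantum_channel_two_kraus:
  fixes A :: "'h::complex_hilbert_space set"
  assumes A: "finite A" "orthonormal A"
    and w: "\<And>a b. a \<in> A \<Longrightarrow> b \<in> A \<Longrightarrow> cinner (w a) (w b) = (if a = b then 1 else 0)"
  shows "quantum_channel
    (two_kraus (partial_isometry A w) (partial_isometry_adj A w) (\<lambda>x. x - proj A x))"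
    (is "quantum_channel ?E")
proof -
  note K = bounded_clinearD[OF bounded_clinear_partial_isometry]
  have pos: "positive_finite_trace (?E X)" "op_trace (?E X) = op_trace X"
    if "positive_finite_trace X" for X
    by (rule two_kraus_positive[OF that A w]; assumption)+
  have "trace_class (?E X) \<and> op_trace (?E X) = op_trace X" if tX: "trace_class X" for X
  proof -
    obtain P1 P2 P3 P4 where P: "positive_finite_trace P1" "positive_finite_trace P2"
      "positive_finite_trace P3" "positive_finite_trace P4"
      and X: "X = (\<lambda>x. (P1 x - P2 x) + \<i> *\<^sub>C (P3 x - P4 x))"
      using tX by (rule trace_classE)
    have EX: "?E X = (\<lambda>x. (?E P1 x - ?E P2 x) + \<i> *\<^sub>C (?E P3 x - ?E P4 x))"
      by (simp add: X two_kraus_def K scaleC_add_right scaleC_diff_right algebra_simps)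
    show ?thesis
    proof
      show "trace_class (?E X)" unfolding trace_class_def using EX P pos(1) by blast
      show "op_trace (?E X) = op_trace X"
        unfolding EX using P pos by (simp add: op_trace_combination X)
    qed
  qed
  moreover have "linear_on_trace_class ?E"
    unfolding linear_on_trace_class_def
    by (auto simp: two_kraus_def K scaleC_add_right scaleC_diff_right algebra_simps)
  moreover have "block_positive n (\<lambda>i j. ?E (X i j))" if X: "block_positive n X" for n X
    unfolding block_positive_def
  proof
    fix v :: "nat \<Rightarrow> 'h"
    let ?K' = "partial_isometry_adj A w" and ?Q = "\<lambda>x. x - proj A x"
    have "(\<Sum>i<n. \<Sum>j<n. cinner (v i) (?E (X i j) (v j))) =
        (\<Sum>i<n. \<Sum>j<n. cinner (?K' (v i)) (X i j (?K' (v j)))) +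
        (\<Sum>i<n. \<Sum>j<n. cinner (?Q (v i)) (X i j (?Q (v j))))"
      unfolding sum.distrib[symmetric]
      by (simp add: two_kraus_def cinner_add_right cinner_partial_isometry
          cinner_diff_right cinner_diff_left proj_adj)
    also have "\<dots> \<in> \<real>\<^sub>\<ge>\<^sub>0"
      using X[unfolded block_positive_def, rule_format, of "\<lambda>i. ?K' (v i)"]
        X[unfolded block_positive_def, rule_format, of "\<lambda>i. ?Q (v i)"]
      by (rule nonneg_Reals_add_I)
    finally show "(\<Sum>i<n. \<Sum>j<n. cinner (v i) (?E (X i j) (v j))) \<in> \<real>\<^sub>\<ge>\<^sub>0" .
  qed
  ultimately show ?thesis
    unfolding quantum_channel_def trace_preserving_def completely_positive_def by blast
qed

section \<open>Isometries between orbits\<close>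

text \<open>The last conjunct says that the \<open>a\<close> and the \<open>w a\<close> are the same linear combinations of
  the \<open>f j\<close> and of the \<open>f' j\<close>, without mentioning coefficients.\<close>

definition matching_frames ::
    "'i set \<Rightarrow> 'i set \<Rightarrow> ('i \<Rightarrow> 'h::complex_hilbert_space) \<Rightarrow> ('i \<Rightarrow> 'h) \<Rightarrow> 'h set \<Rightarrow> ('h \<Rightarrow> 'h) \<Rightarrow> bool" where
  "matching_frames J I f f' A w \<longleftrightarrow> finite A \<and> orthonormal A \<and>
    (\<forall>a\<in>A. \<forall>b\<in>A. cinner (w a) (w b) = (if a = b then 1 else 0)) \<and>
    (\<forall>i\<in>I. f i = (\<Sum>a\<in>A. cinner a (f i) *\<^sub>C a)) \<and>
    (\<forall>i\<in>I. f' i = (\<Sum>a\<in>A. cinner a (f i) *\<^sub>C w a)) \<and>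
    (\<forall>a\<in>A. \<forall>x y. (\<forall>j\<in>J. cinner (f j) x = cinner (f' j) y) \<longrightarrow> cinner a x = cinner (w a) y)"

lemma matching_framesD:
  assumes "matching_frames J I f f' A w"
  shows "finite A" "orthonormal A"
    and "\<And>a b. a \<in> A \<Longrightarrow> b \<in> A \<Longrightarrow> cinner (w a) (w b) = (if a = b then 1 else 0)"
    and "\<And>i. i \<in> I \<Longrightarrow> f i = (\<Sum>a\<in>A. cinner a (f i) *\<^sub>C a)"
    and "\<And>i. i \<in> I \<Longrightarrow> f' i = (\<Sum>a\<in>A. cinner a (f i) *\<^sub>C w a)"
    and "\<And>a x y. a \<in> A \<Longrightarrow> (\<And>j. j \<in> J \<Longrightarrow> cinner (f j) x = cinner (f' j) y) \<Longrightarrow>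
      cinner a x = cinner (w a) y"
  using assms unfolding matching_frames_def by blast+

text \<open>Gram-Schmidt carried out on both families at once. \<open>I\<close> grows while
  \<open>J\<close> stays fixed, so the last conjunct of \<open>matching_frames\<close> passes
  unchanged from stage to stage and can be tested on the pair \<open>f i\<close>,
  \<open>f' i\<close> that is about to be added.\<close>

lemma ex_matching_frames:
  fixes f f' :: "'i \<Rightarrow> 'h::complex_hilbert_space"
  assumes "finite I" "I \<subseteq> J"
    and gram: "\<And>i j. i \<in> J \<Longrightarrow> j \<in> J \<Longrightarrow> cinner (f i) (f j) = cinner (f' i) (f' j)"
  shows "\<exists>A w. matching_frames J I f f' A w"
  using assms(1,2)
proof (induction I rule: finite_induct)
  case empty
  show ?case by (intro exI[of _ "{}"]) (simp add: matching_frames_def orthonormal_def)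
next
  case (insert i I)
  then obtain A w where mf: "matching_frames J I f f' A w" by auto
  note A = matching_framesD(1,2)[OF mf] and w = matching_framesD(3)[OF mf]
    and f = matching_framesD(4)[OF mf] and f' = matching_framesD(5)[OF mf]
    and inv = matching_framesD(6)[OF mf]
  have iJ: "i \<in> J" using insert by auto
  define p where "p = (\<Sum>a\<in>A. cinner a (f i) *\<^sub>C a)"
  define p' where "p' = (\<Sum>a\<in>A. cinner a (f i) *\<^sub>C w a)"
  define r where "r = f i - p"
  define r' where "r' = f' i - p'"
  have af: "cinner a (f i) = cinner (w a) (f' i)" if "a \<in> A" for a
    using that gram iJ by (intro inv) auto
  have ar: "cinner a r = 0" if "a \<in> A" for a
    using that A by (simp add: r_def p_def cinner_diff_right orthonormal_sum_right)
  have wr: "cinner (w a) r' = 0" if "a \<in> A" for a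
  proof -
    have "cinner (w a) p' = (\<Sum>b\<in>A. if b = a then cinner a (f i) else 0)"
      unfolding p'_def cinner_sum_right cinner_scaleC_right using that by (intro sum.cong) (auto simp: w)
    also have "\<dots> = cinner a (f i)" using that A(1) by simp
    finally show ?thesis using af[OF that] by (simp add: r'_def cinner_diff_right)
  qed
  \<comment> \<open>The residuals are the same linear combination of the two families, so the test
    carries over to them.\<close>
  have inv_r: "cinner r x = cinner r' y" if "\<And>j. j \<in> J \<Longrightarrow> cinner (f j) x = cinner (f' j) y" for x y
  proof -
    have "cinner p x = cinner p' y"
      unfolding p_def p'_def cinner_sum_left cinner_scaleC_left
      using inv[OF _ that] by (intro sum.cong) auto
    thus ?thesis using that[OF iJ] by (simp add: r_def r'_def cinner_diff_left)
  qed
  \<comment> \<open>Orthogonality turns the squared norms of the residuals into inner products with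
    \<open>f i\<close> and \<open>f' i\<close>, where \<open>inv_r\<close> applies. Equal norms mean
    that both residuals vanish together, or can be normalised by one common factor.\<close>
  have "cinner r p = 0" "cinner r' p' = 0"
    using ar wr cinner_commute[of r] cinner_commute[of r']
    by (simp_all add: p_def p'_def cinner_sum_right cinner_scaleC_right)
  hence rf: "cinner r r = cinner r (f i)" "cinner r' r' = cinner r' (f' i)"
    by (metis cinner_diff_right diff_zero r_def, metis cinner_diff_right diff_zero r'_def)
  moreover have "cinner r (f i) = cinner r' (f' i)"
    using gram iJ by (intro inv_r) auto
  ultimately have rr: "cinner r r = cinner r' r'" by simp
  show ?case
  proof (cases "r = 0")
    case True
    hence "r' = 0" using rr by simp
    with True have "f i = p" "f' i = p'" by (simp_all add: r_def r'_def)
    thus ?thesis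
      using mf unfolding matching_frames_def p_def p'_def
      by (intro exI[of _ A] exI[of _ w]) simp
  next
    case False
    define n where "n = complex_of_real (norm r)"
    have n0: "n \<noteq> 0" and cn: "cnj n = n" and nn: "cinner r r = n * n"
      using False by (simp_all add: n_def cinner_self power2_eq_square)
    define u where "u = inverse n *\<^sub>C r"
    define u' where "u' = inverse n *\<^sub>C r'"
    define w' where "w' = w(u := u')"
    have uu: "cinner u u = 1" "cinner u' u' = 1"
      using n0 nn rr by (simp_all add: u_def u'_def cinner_scaleC_left cinner_scaleC_right cn field_simps)
    have au: "cinner a u = 0" "cinner u a = 0" "cinner (w a) u' = 0" "cinner u' (w a) = 0"
      if "a \<in> A" for a
      using ar[OF that] wr[OF that] cinner_commute[of a r] cinner_commute[of "w a" r']
      by (simp_all add: u_def u'_def cinner_scaleC_left cinner_scaleC_right)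
    have uA: "u \<notin> A" using uu au by force
    have w'a: "w' a = w a" if "a \<in> A" for a using that uA by (auto simp: w'_def)
    have w'u: "w' u = u'" by (simp add: w'_def)
    \<comment> \<open>The earlier vectors have no component along \<open>u\<close>, so their
      expansions survive the enlargement of the frame.\<close>
    have uf: "cinner u (f j) = 0" if "j \<in> I" for j
    proof -
      have "cinner u (\<Sum>a\<in>A. cinner a (f j) *\<^sub>C a) = 0"
        by (simp add: cinner_sum_right cinner_scaleC_right au)
      thus ?thesis using f[OF that] by simp
    qed
    have ui: "cinner u (f i) = n"
      using n0 nn rf by (simp add: u_def cinner_scaleC_left cn field_simps)
    have nu: "n *\<^sub>C u = r" "n *\<^sub>C u' = r'" using n0 by (simp_all add: u_def u'_def scaleC_scaleC)
    have sum': "(\<Sum>a\<in>A. c a *\<^sub>C w' a) = (\<Sum>a\<in>A. c a *\<^sub>C w a)" for c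
      by (intro sum.cong) (simp_all add: w'a)
    show ?thesis
      unfolding matching_frames_def
    proof (intro exI[of _ "insert u A"] exI[of _ w'] conjI ballI allI impI)
      show "finite (insert u A)" using A by simp
      show "orthonormal (insert u A)" using A(2) uu au unfolding orthonormal_def by auto
    next
      fix a b assume "a \<in> insert u A" "b \<in> insert u A"
      thus "cinner (w' a) (w' b) = (if a = b then 1 else 0)"
        using uA w uu au by (auto simp: w'a w'u)
    next
      fix j assume j: "j \<in> insert i I"
      show "f j = (\<Sum>a\<in>insert u A. cinner a (f j) *\<^sub>C a)"
        using j A(1) uA uf[of j] f[of j]
        by (cases "j = i") (simp_all add: ui nu r_def flip: p_def)
    next
      fix j assume j: "j \<in> insert i I"
      show "f' j = (\<Sum>a\<in>insert u A. cinner a (f j) *\<^sub>C w' a)"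
        using j A(1) uA uf[of j] f'[of j]
        by (cases "j = i") (simp_all add: ui nu r'_def w'u sum' flip: p'_def)
    next
      fix a x y assume a: "a \<in> insert u A" and xy: "\<forall>j\<in>J. cinner (f j) x = cinner (f' j) y"
      show "cinner a x = cinner (w' a) y"
      proof (cases "a = u")
        case True
        have "cinner r x = cinner r' y" using xy by (intro inv_r) auto
        thus ?thesis unfolding True w'u by (simp add: u_def u'_def cinner_scaleC_left)
      next
        case False
        thus ?thesis using a xy inv[of a x y] by (simp add: w'a)
      qed
    qed
  qed
qed

section \<open>Unitary operators, representations and covariance\<close>

lemma unitary_opD:
  assumes "unitary_op V"
  shows "bounded_clinear V" "surj V" "cinner (V x) (V y) = cinner x y"
  using assms by (auto simp: unitary_op_def)

text \<open>The hypotheses \<open>ex\<close> and \<open>ex'\<close> say that the families are stable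
  under the inverse of \<open>V\<close> and under \<open>V\<close>, up to the phase on the second
  one. The first yields that K(V x) is the projection \<open>z\<close> of \<open>y\<close> onto the
  span of the \<open>w a\<close>. The second shows that \<open>y\<close> already lies there: the
  residue, pulled back along \<open>V\<close>, is orthogonal to all \<open>f' j\<close>, hence to K
  x.\<close>

lemma partial_isometry_intertwines:
  fixes f f' :: "'i \<Rightarrow> 'h::complex_hilbert_space"
  assumes V: "unitary_op V" and \<omega>: "\<omega> * cnj \<omega> = 1"
    and mf: "matching_frames J J f f' A w"
    and ex: "\<And>j. j \<in> J \<Longrightarrow> \<exists>k\<in>J. f j = V (f k) \<and> f' j = \<omega> *\<^sub>C V (f' k)"
    and ex': "\<And>j. j \<in> J \<Longrightarrow> \<exists>k\<in>J. f' k = \<omega> *\<^sub>C V (f' j)"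
  shows "partial_isometry A w (V x) = \<omega> *\<^sub>C V (partial_isometry A w x)"
proof -
  note A = matching_framesD(1)[OF mf] and w = matching_framesD(3)[OF mf]
    and f = matching_framesD(4)[OF mf] and f' = matching_framesD(5)[OF mf]
    and inv = matching_framesD(6)[OF mf]
  let ?K = "partial_isometry A w"
  define y where "y = \<omega> *\<^sub>C V (?K x)"
  \<comment> \<open>K is isometric on the span of \<open>A\<close>, which contains
    \<open>f j\<close>, and it maps \<open>f j\<close> to \<open>f' j\<close>.\<close>
  have fK: "cinner (f' j) (?K x) = cinner (f j) x" if "j \<in> J" for j
  proof -
    have wK: "cinner (w a) (?K x) = cinner a x" if "a \<in> A" for a
    proof -
      have "cinner (w a) (?K x) = (\<Sum>b\<in>A. if b = a then cinner a x else 0)"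
        unfolding partial_isometry_def cinner_sum_right cinner_scaleC_right
        using that by (intro sum.cong) (auto simp: w)
      thus ?thesis using A that by simp
    qed
    have "cinner (f' j) (?K x) = (\<Sum>a\<in>A. cnj (cinner a (f j)) * cinner a x)"
      by (subst f'[OF that]) (simp add: cinner_sum_left cinner_scaleC_left wK)
    also have "\<dots> = cinner (f j) x"
      by (subst (2) f[OF that]) (simp add: cinner_sum_left cinner_scaleC_left)
    finally show ?thesis .
  qed
  have coeff: "cinner a (V x) = cinner (w a) y" if "a \<in> A" for a
  proof (rule inv[OF that])
    fix j assume "j \<in> J"
    then obtain k where k: "k \<in> J" "f j = V (f k)" "f' j = \<omega> *\<^sub>C V (f' k)" using ex by blast
    have "cinner (f' j) y = cnj \<omega> * (\<omega> * cinner (f' k) (?K x))"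
      by (simp add: k y_def cinner_scaleC_left cinner_scaleC_right unitary_opD[OF V])
    also have "\<dots> = (\<omega> * cnj \<omega>) * cinner (f k) x" using fK[OF k(1)] by simp
    finally show "cinner (f j) (V x) = cinner (f' j) y"
      by (simp add: k unitary_opD[OF V] \<omega>)
  qed
  define z where "z = (\<Sum>a\<in>A. cinner (w a) y *\<^sub>C w a)"
  have wd: "cinner (w a) (y - z) = 0" if "a \<in> A" for a
  proof -
    have "cinner (w a) z = (\<Sum>b\<in>A. if b = a then cinner (w a) y else 0)"
      unfolding z_def cinner_sum_right cinner_scaleC_right using that by (intro sum.cong) (auto simp: w)
    thus ?thesis using A that by (simp add: cinner_diff_right)
  qed
  obtain d where d: "y - z = V d" using unitary_opD(2)[OF V] by (metis surjD)
  have "cinner (w a) d = 0" if "a \<in> A" for a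
  proof -
    \<comment> \<open>Testing the pair \<open>0\<close>, \<open>d\<close> reduces orthogonality to
      \<open>w a\<close> to orthogonality to the second family.\<close>
    have "cinner a 0 = cinner (w a) d"
    proof (rule inv[OF that])
      fix j assume "j \<in> J"
      then obtain k where k: "k \<in> J" "f' k = \<omega> *\<^sub>C V (f' j)" using ex' by blast
      have "cinner (f' k) (y - z) = 0"
        by (subst f'[OF k(1)]) (simp add: cinner_sum_left cinner_scaleC_left wd)
      hence "cnj \<omega> * cinner (f' j) d = 0"
        by (simp add: k(2) d cinner_scaleC_left unitary_opD[OF V])
      moreover have "cnj \<omega> \<noteq> 0" using \<omega> by auto
      ultimately show "cinner (f j) 0 = cinner (f' j) d" by simp
    qed
    thus ?thesis by simp
  qed
  hence "cinner (?K x) d = 0"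
    by (simp add: partial_isometry_def cinner_sum_left cinner_scaleC_left)
  hence "cinner y (y - z) = 0"
    unfolding d by (simp add: y_def cinner_scaleC_left unitary_opD[OF V])
  moreover have "cinner z (y - z) = 0"
    by (subst (1) z_def) (simp add: cinner_sum_left cinner_scaleC_left wd)
  ultimately have "cinner (y - z) (y - z) = 0" by (simp only: cinner_diff_left diff_self)
  hence "y = z" by simp
  moreover have "?K (V x) = z"
    unfolding partial_isometry_def z_def by (intro sum.cong) (simp_all add: coeff)
  ultimately show ?thesis by (simp add: y_def)
qed

text \<open>\<open>unitary_rep\<close> does not postulate this; an idempotent surjection is the
  identity.\<close>

lemma unitary_rep_one:
  assumes "group G" "unitary_rep G U"
  shows "U \<one>\<^bsub>G\<^esub> x = x"
proof -
  interpret group G by fact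
  have "unitary_op (U \<one>\<^bsub>G\<^esub>)" "U \<one>\<^bsub>G\<^esub> = U \<one>\<^bsub>G\<^esub> \<circ> U \<one>\<^bsub>G\<^esub>"
    using assms(2) one_closed l_one[OF one_closed] unfolding unitary_rep_def by metis+
  moreover from this(1) obtain y where "x = U \<one>\<^bsub>G\<^esub> y"
    using unitary_opD(2) by (metis surjD)
  ultimately show ?thesis by (metis comp_apply)
qed

lemma unitary_rep_inv:
  assumes "group G" "unitary_rep G U" "g \<in> carrier G"
  shows "U g (U (inv\<^bsub>G\<^esub> g) x) = x" "U (inv\<^bsub>G\<^esub> g) (U g x) = x"
proof -
  interpret group G by fact
  have "U g (U (inv\<^bsub>G\<^esub> g) x) = U (g \<otimes>\<^bsub>G\<^esub> inv\<^bsub>G\<^esub> g) x"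
    "U (inv\<^bsub>G\<^esub> g) (U g x) = U (inv\<^bsub>G\<^esub> g \<otimes>\<^bsub>G\<^esub> g) x"
    using assms(2,3) inv_closed[OF assms(3)] unfolding unitary_rep_def by (metis comp_apply)+
  thus "U g (U (inv\<^bsub>G\<^esub> g) x) = x" "U (inv\<^bsub>G\<^esub> g) (U g x) = x"
    using assms(3) unitary_rep_one[OF assms(1,2)] by simp_all
qed

lemma cinner_unitary_rep:
  assumes "group G" "unitary_rep G U" "g \<in> carrier G"
  shows "cinner (U g x) y = cinner x (U (inv\<^bsub>G\<^esub> g) y)"
  using assms unitary_opD(3)[of "U g" x "U (inv\<^bsub>G\<^esub> g) y"] unitary_rep_inv(1)[OF assms]
  by (auto simp: unitary_rep_def)

lemma cadjoint_unitary_rep: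
  assumes "group G" "unitary_rep G U" "g \<in> carrier G"
  shows "cadjoint (U g) = U (inv\<^bsub>G\<^esub> g)"
proof -
  have inv: "inv\<^bsub>G\<^esub> g \<in> carrier G" using assms by (simp add: group.inv_closed)
  have *: "cinner (U (inv\<^bsub>G\<^esub> g) x) y = cinner x (U g y)" for x y
    using cinner_unitary_rep[OF assms(1,2) inv, of x y] assms by (simp add: group.inv_inv)
  show ?thesis
    unfolding cadjoint_def
  proof (rule the_equality)
    fix B assume B: "\<forall>x y. cinner (B x) y = cinner x (U g y)"
    show "B = U (inv\<^bsub>G\<^esub> g)"
    proof (rule ext, rule cinner_ext)
      fix x u
      show "cinner u (B x) = cinner u (U (inv\<^bsub>G\<^esub> g) x)"
        using B * cinner_commute by metis
    qed
  qed (simp add: *)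
qed

text \<open>Moving \<open>U g\<close> past \<open>K\<close> on the left costs a phase, moving its
  inverse past \<open>K'\<close> on the right costs the conjugate phase, and their product is
  1.\<close>

lemma covariant_two_kraus:
  fixes U :: "'g \<Rightarrow> 'h::complex_hilbert_space \<Rightarrow> 'h"
  assumes G: "group G" and U: "unitary_rep G U"
    and \<omega>: "\<And>g. g \<in> carrier G \<Longrightarrow> \<omega> g * cnj (\<omega> g) = 1"
    and K: "bounded_clinear K" and adj: "\<And>x y. cinner (K' x) y = cinner x (K y)"
    and Q: "bounded_clinear Q"
    and KU: "\<And>g x. g \<in> carrier G \<Longrightarrow> K (U g x) = \<omega> g *\<^sub>C U g (K x)"
    and QU: "\<And>g x. g \<in> carrier G \<Longrightarrow> Q (U g x) = U g (Q x)"
  shows "covariant G U (two_kraus K K' Q)"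
  unfolding covariant_def
proof (intro ballI allI impI ext)
  fix g and X :: "'h \<Rightarrow> 'h" and x assume g: "g \<in> carrier G" and "trace_class X"
  hence X: "bounded_clinear X" by (simp add: trace_class_imp_bounded_clinear)
  let ?V = "U (inv\<^bsub>G\<^esub> g)"
  have g': "inv\<^bsub>G\<^esub> g \<in> carrier G" using G g by (simp add: group.inv_closed)
  have Ug: "unitary_op (U g)" "unitary_op ?V" using U g g' by (auto simp: unitary_rep_def)
  have K'U: "?V (K' x) = cnj (\<omega> g) *\<^sub>C K' (?V x)"
  proof (rule cinner_ext)
    fix u
    have "cinner (?V (K' x)) u = cinner (K' x) (U g u)"
      using cinner_unitary_rep[OF G U g', of "K' x" u] G g by (simp add: group.inv_inv)
    also have "\<dots> = \<omega> g * cinner x (U g (K u))"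
      by (simp add: adj KU g cinner_scaleC_right)
    also have "cinner x (U g (K u)) = cinner (K' (?V x)) u"
      using cinner_unitary_rep[OF G U g', of x "K u"] G g by (simp add: adj group.inv_inv)
    finally have "cnj (cinner (?V (K' x)) u) = cnj (\<omega> g) * cnj (cinner (K' (?V x)) u)" by simp
    thus "cinner u (?V (K' x)) = cinner u (cnj (\<omega> g) *\<^sub>C K' (?V x))"
      unfolding cinner_scaleC_right cinner_commute[of u] .
  qed
  have "two_kraus K K' Q (U g \<circ> X \<circ> ?V) x = (\<omega> g * cnj (\<omega> g)) *\<^sub>C U g (K (X (K' (?V x)))) +
      U g (Q (X (Q (?V x))))"
    by (simp add: two_kraus_def K'U KU[OF g] QU[OF g] QU[OF g', symmetric] scaleC_scaleC mult.commute
        bounded_clinearD(3)[OF X] bounded_clinearD(3)[OF K]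
        bounded_clinearD(3)[OF unitary_opD(1)[OF Ug(1)]])
  also have "\<dots> = U g (two_kraus K K' Q X (?V x))"
    using g by (simp add: \<omega> two_kraus_def bounded_clinearD(1)[OF unitary_opD(1)[OF Ug(1)]])
  finally show "two_kraus K K' Q (U g \<circ> X \<circ> cadjoint (U g)) x =
      (U g \<circ> two_kraus K K' Q X \<circ> cadjoint (U g)) x"
    using cadjoint_unitary_rep[OF G U g] by simp
qed

text \<open>An abstract unimodular multiplicative \<open>\<omega>\<close> takes the place of the
  exponential, so that the reverse conversion is the instance with the conjugate phase.\<close>

lemma cov_convertible_of_phase:
  fixes \<psi> \<phi> :: "'h::complex_hilbert_space"
  assumes G: "group G" "finite (carrier G)" and U: "unitary_rep G U"
    and \<omega>: "\<And>g. g \<in> carrier G \<Longrightarrow> \<omega> g * cnj (\<omega> g) = 1"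
    and \<omega>_mult: "\<And>g h. g \<in> carrier G \<Longrightarrow> h \<in> carrier G \<Longrightarrow> \<omega> (g \<otimes>\<^bsub>G\<^esub> h) = \<omega> g * \<omega> h"
    and char: "\<And>g. g \<in> carrier G \<Longrightarrow> char_fun U \<psi> g = char_fun U \<phi> g * \<omega> g"
  shows "cov_convertible G U (pure_state \<psi>) (pure_state \<phi>)"
proof -
  interpret group G by fact
  have U_mult: "U (g \<otimes>\<^bsub>G\<^esub> h) x = U g (U h x)" if "g \<in> carrier G" "h \<in> carrier G" for g h x
    using U that by (auto simp: unitary_rep_def)
  have U_op: "unitary_op (U g)" if "g \<in> carrier G" for g
    using U that by (auto simp: unitary_rep_def)
  have "\<omega> \<one>\<^bsub>G\<^esub> * \<omega> \<one>\<^bsub>G\<^esub> = \<omega> \<one>\<^bsub>G\<^esub>" "\<omega> \<one>\<^bsub>G\<^esub> \<noteq> 0"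
    using \<omega>_mult[of "\<one>\<^bsub>G\<^esub>" "\<one>\<^bsub>G\<^esub>"] \<omega>[of "\<one>\<^bsub>G\<^esub>"] by auto
  hence \<omega>_one: "\<omega> \<one>\<^bsub>G\<^esub> = 1" by simp
  have \<omega>_inv: "\<omega> (inv\<^bsub>G\<^esub> g) = cnj (\<omega> g)" if "g \<in> carrier G" for g
  proof -
    have "\<omega> g * \<omega> (inv\<^bsub>G\<^esub> g) = \<omega> g * cnj (\<omega> g)" "\<omega> g \<noteq> 0"
      using \<omega>_mult[of g "inv\<^bsub>G\<^esub> g"] that \<omega>_one \<omega>[OF that] by auto
    thus ?thesis by simp
  qed
  define f where "f g = U g \<psi>" for g
  \<comment> \<open>With the phase placed in the orbit of \<open>\<phi>\<close> the two Gram
    matrices coincide: entries depend on the product of the inverse of g with h, and there the phase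
    is \<open>cnj (\<omega> g) * \<omega> h\<close>.\<close>
  define f' where "f' g = \<omega> g *\<^sub>C U g \<phi>" for g
  have gram: "cinner (f g) (f h) = cinner (f' g) (f' h)" if gh: "g \<in> carrier G" "h \<in> carrier G" for g h
  proof -
    have *: "cinner (U g x) (U h x) = char_fun U x (inv\<^bsub>G\<^esub> g \<otimes>\<^bsub>G\<^esub> h)" for x
      using gh by (simp add: cinner_unitary_rep[OF G(1) U] U_mult char_fun_def)
    show ?thesis
      using gh by (simp add: f_def f'_def cinner_scaleC_left cinner_scaleC_right * char \<omega>_mult \<omega>_inv)
  qed
  have "\<exists>A w. matching_frames (carrier G) (carrier G) f f' A w"
    by (rule ex_matching_frames[OF G(2) order.refl]) (rule gram)
  then obtain A w where mf: "matching_frames (carrier G) (carrier G) f f' A w" by blast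
  note A = matching_framesD(1,2)[OF mf] and w = matching_framesD(3)[OF mf]
    and f = matching_framesD(4)[OF mf] and f' = matching_framesD(5)[OF mf]
    and inv = matching_framesD(6)[OF mf]
  have inv': "cinner a x = cinner a y"
    if "a \<in> A" "\<And>j. j \<in> carrier G \<Longrightarrow> cinner (f j) x = cinner (f j) y" for a x y
  proof -
    \<comment> \<open>A test against one family becomes a test against both by comparing the
      difference with 0.\<close>
    have "cinner a (x - y) = cinner (w a) 0"
      using that by (intro inv) (simp_all add: cinner_diff_right)
    thus ?thesis by (simp add: cinner_diff_right)
  qed
  \<comment> \<open>This makes the projection a special case of the partial isometry, so the
    intertwining result with phase 1 shows that it commutes with every \<open>U g\<close>.\<close>
  have mf': "matching_frames (carrier G) (carrier G) f f A (\<lambda>a. a)"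
    unfolding matching_frames_def
  proof (intro conjI ballI allI impI)
    show "cinner a b = (if a = b then 1 else 0)" if "a \<in> A" "b \<in> A" for a b
      using A(2) that unfolding orthonormal_def by blast
    show "cinner a x = cinner a y"
      if "a \<in> A" "\<forall>j\<in>carrier G. cinner (f j) x = cinner (f j) y" for a x y
      using inv'[of a x y] that by blast
  qed (use A f in blast)+
  let ?K = "partial_isometry A w" and ?K' = "partial_isometry_adj A w" and ?Q = "\<lambda>x. x - proj A x"
  have f_shift: "f (g \<otimes>\<^bsub>G\<^esub> h) = U g (f h)" "f' (g \<otimes>\<^bsub>G\<^esub> h) = \<omega> g *\<^sub>C U g (f' h)"
    if "g \<in> carrier G" "h \<in> carrier G" for g h
    using that by (simp_all add: f_def f'_def U_mult \<omega>_mult scaleC_scaleC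
        bounded_clinearD(3)[OF unitary_opD(1)[OF U_op]])
  have split: "g \<otimes>\<^bsub>G\<^esub> (inv\<^bsub>G\<^esub> g \<otimes>\<^bsub>G\<^esub> h) = h" if "g \<in> carrier G" "h \<in> carrier G" for g h
    using that by (simp add: m_assoc[symmetric])
  have ex: "\<exists>k\<in>carrier G. f j = U g (f k) \<and> f' j = \<omega> g *\<^sub>C U g (f' k)"
    if "g \<in> carrier G" "j \<in> carrier G" for g j
    using that f_shift[of g "inv\<^bsub>G\<^esub> g \<otimes>\<^bsub>G\<^esub> j"] split[of g j]
    by (intro bexI[of _ "inv\<^bsub>G\<^esub> g \<otimes>\<^bsub>G\<^esub> j"]) auto
  have KU: "?K (U g x) = \<omega> g *\<^sub>C U g (?K x)" if g: "g \<in> carrier G" for g x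
  proof (rule partial_isometry_intertwines[OF U_op[OF g] \<omega>[OF g] mf ex[OF g]])
    fix j assume "j \<in> carrier G"
    thus "\<exists>k\<in>carrier G. f' k = \<omega> g *\<^sub>C U g (f' j)"
      using g f_shift(2)[of g j] by (intro bexI[of _ "g \<otimes>\<^bsub>G\<^esub> j"]) auto
  qed
  have PU: "proj A (U g x) = 1 *\<^sub>C U g (proj A x)" if g: "g \<in> carrier G" for g x
  proof (rule partial_isometry_intertwines[OF U_op[OF g] _ mf'])
    fix j assume j: "j \<in> carrier G"
    show "\<exists>k\<in>carrier G. f k = 1 *\<^sub>C U g (f j)"
      using g j f_shift(1)[of g j] by (intro bexI[of _ "g \<otimes>\<^bsub>G\<^esub> j"]) auto
    show "\<exists>k\<in>carrier G. f j = U g (f k) \<and> f j = 1 *\<^sub>C U g (f k)"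
      using ex[OF g j] by auto
  qed simp
  have "covariant G U (two_kraus ?K ?K' ?Q)"
  proof (rule covariant_two_kraus[OF G(1) U \<omega> bounded_clinear_partial_isometry])
    show "bounded_clinear ?Q"
      by (intro bounded_clinear_diff bounded_clinear_ident bounded_clinear_partial_isometry)
    show "?Q (U g x) = U g (?Q x)" if "g \<in> carrier G" for g x
      using PU[OF that] by (simp add: bounded_clinearD(2)[OF unitary_opD(1)[OF U_op[OF that]]])
  qed (use KU in \<open>simp_all add: cinner_partial_isometry\<close>)
  moreover have "quantum_channel (two_kraus ?K ?K' ?Q)"
    by (rule quantum_channel_two_kraus[OF A w])
  \<comment> \<open>Since \<open>\<psi>\<close> belongs to the orbit, it lies in the span of
    \<open>A\<close>, and the complementary term vanishes on its state.\<close>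
  moreover have "two_kraus ?K ?K' ?Q (pure_state \<psi>) = pure_state \<phi>"
  proof -
    have "f \<one>\<^bsub>G\<^esub> = \<psi>" "f' \<one>\<^bsub>G\<^esub> = \<phi>"
      by (simp_all add: f_def f'_def \<omega>_one unitary_rep_one[OF G(1) U])
    moreover have "?K (f \<one>\<^bsub>G\<^esub>) = f' \<one>\<^bsub>G\<^esub>" "proj A (f \<one>\<^bsub>G\<^esub>) = f \<one>\<^bsub>G\<^esub>"
      unfolding partial_isometry_def
      by (rule f'[OF one_closed, symmetric], rule f[OF one_closed, symmetric])
    ultimately have K\<psi>: "?K \<psi> = \<phi>" and P\<psi>: "proj A \<psi> = \<psi>" by simp_all
    show ?thesis
    proof (rule ext)
      fix x
      have "cinner \<psi> (?K' x) = cinner \<phi> x"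
        using cinner_partial_isometry[of x A w \<psi>] K\<psi> by (metis cinner_commute)
      moreover have "cinner \<psi> (?Q x) = 0"
        using P\<psi> cinner_partial_isometry[of \<psi> A "\<lambda>a. a" x] by (simp add: cinner_diff_right proj_adj)
      ultimately show "two_kraus ?K ?K' ?Q (pure_state \<psi>) x = pure_state \<phi> x"
        by (simp add: two_kraus_def pure_state_def K\<psi> P\<psi>
            bounded_clinearD(3,5)[OF bounded_clinear_partial_isometry])
    qed
  qed
  ultimately show ?thesis unfolding cov_convertible_def by blast
qed

section \<open>Necessity of the phase relation\<close>

text \<open>Put \<open>u\<close> in slot \<open>i\<close> and \<open>t *\<^sub>C x\<close> in slot
  \<open>j\<close>. The term quadratic in \<open>t\<close> is the vanishing diagonal value, so the
  form is affine in \<open>t\<close>; it can stay nonnegative only if both coefficients are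
  zero.\<close>

lemma block_positive_null:
  assumes pos: "block_positive n Y" and ij: "i < n" "j < n" "i \<noteq> j"
    and lin: "\<And>i j. i < n \<Longrightarrow> j < n \<Longrightarrow> bounded_clinear (Y i j)"
    and null: "cinner x (Y j j x) = 0"
  shows "cinner u (Y i j x) = 0" "cinner x (Y j i u) = 0"
proof -
  have "cinner u (Y i i u) + t * cinner u (Y i j x) + cnj t * cinner x (Y j i u) \<in> \<real>\<^sub>\<ge>\<^sub>0" for t
  proof -
    define v where "v k = (if k = i then u else if k = j then t *\<^sub>C x else 0)" for k
    have v: "v i = u" "v j = t *\<^sub>C x" "\<And>k. k \<notin> {i, j} \<Longrightarrow> v k = 0"
      using ij by (auto simp: v_def)
    have "(\<Sum>k<n. \<Sum>l<n. cinner (v k) (Y k l (v l))) = (\<Sum>k\<in>{i,j}. \<Sum>l<n. cinner (v k) (Y k l (v l)))"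
      using ij by (intro sum.mono_neutral_right) (auto simp: v(3))
    also have "\<dots> = (\<Sum>k\<in>{i,j}. \<Sum>l\<in>{i,j}. cinner (v k) (Y k l (v l)))"
      using ij by (intro sum.cong refl sum.mono_neutral_right)
        (auto simp: v(3) bounded_clinearD(5)[OF lin])
    also have "\<dots> = cinner u (Y i i u) + t * cinner u (Y i j x) + cnj t * cinner x (Y j i u)"
      using ij by (simp add: v(1,2) bounded_clinearD(3)[OF lin] cinner_scaleC_left
          cinner_scaleC_right null)
    finally show ?thesis
      using pos[unfolded block_positive_def, THEN spec, of v] by (simp only:)
  qed
  thus "cinner u (Y i j x) = 0" "cinner x (Y j i u) = 0"
    by (rule nonneg_affine_imp_zero)+
qed

text \<open>Vectors orthogonal to \<open>e k\<close> have zero expectation in the block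
  \<open>Y k k\<close>. Hence \<open>Y i j\<close> kills the complement of \<open>e j\<close> and
  takes values along \<open>e i\<close>, which leaves a single scalar.\<close>

lemma block_positive_rank_one_diagonal:
  assumes pos: "block_positive n Y"
    and lin: "\<And>i j. i < n \<Longrightarrow> j < n \<Longrightarrow> bounded_clinear (Y i j)"
    and diag: "\<And>i. i < n \<Longrightarrow> Y i i = ketbra (e i) (e i)"
    and e: "\<And>i. i < n \<Longrightarrow> norm (e i) = 1"
    and ij: "i < n" "j < n"
  shows "Y i j = (\<lambda>x. cinner (e i) (Y i j (e j)) *\<^sub>C ketbra (e i) (e j) x)"
proof (cases "i = j")
  case True
  have "cinner (e j) (e j) = 1" using e[OF ij(2)] by (simp add: cinner_self_eq_1_iff)
  thus ?thesis unfolding True diag[OF ij(2)] by (simp add: ketbra_def cinner_scaleC_right)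
next
  case False
  have e1: "cinner (e k) (e k) = 1" if "k < n" for k
    using e[OF that] by (simp add: cinner_self_eq_1_iff)
  define pr where "pr k x = x - cinner (e k) x *\<^sub>C e k" for k x
  have pr: "x = cinner (e k) x *\<^sub>C e k + pr k x" for k x by (simp add: pr_def)
  have null: "cinner (pr k x) (Y k k (pr k x)) = 0" if "k < n" for k x
    using e1[OF that] diag[OF that]
    by (simp add: ketbra_def pr_def cinner_diff_right cinner_scaleC_right)
  show ?thesis
  proof (rule ext, rule cinner_ext)
    fix x u
    have Yx: "cinner w (Y i j (pr j x)) = 0" for w
      by (rule block_positive_null(1)[OF pos ij False lin null[OF ij(2)]])
    have Yu: "cinner (pr i u) (Y i j w) = 0" for w
      by (rule block_positive_null(2)[OF pos ij(2,1) False[symmetric] lin null[OF ij(1)]])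
    have "cinner u (Y i j x) = cinner u (Y i j (cinner (e j) x *\<^sub>C e j))"
      by (subst pr[of x j]) (simp add: bounded_clinearD(1)[OF lin[OF ij]] cinner_add_right Yx)
    also have "\<dots> = cinner (e j) x * cinner u (Y i j (e j))"
      by (simp add: bounded_clinearD(3)[OF lin[OF ij]] cinner_scaleC_right)
    also have "cinner u (Y i j (e j)) = cinner (cinner (e i) u *\<^sub>C e i) (Y i j (e j))"
      by (subst pr[of u i]) (simp add: cinner_add_left Yu)
    also have "\<dots> = cinner u (e i) * cinner (e i) (Y i j (e j))"
      using cinner_commute[of u "e i"] by (simp add: cinner_scaleC_left)
    finally show "cinner u (Y i j x) =
        cinner u (cinner (e i) (Y i j (e j)) *\<^sub>C ketbra (e i) (e j) x)"
      by (simp add: ketbra_def cinner_scaleC_right mult_ac)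
  qed
qed

section \<open>Characteristic functions and positive definite functions on the group\<close>

lemma char_fun_one:
  assumes "group G" "unitary_rep G U" "norm \<psi> = 1"
  shows "char_fun U \<psi> \<one>\<^bsub>G\<^esub> = 1"
  using assms by (simp add: char_fun_def unitary_rep_one cinner_self_eq_1_iff)

lemma char_fun_inv:
  assumes "group G" "unitary_rep G U" "g \<in> carrier G"
  shows "char_fun U \<psi> (inv\<^bsub>G\<^esub> g) = cnj (char_fun U \<psi> g)"
  using cinner_unitary_rep[OF assms, of \<psi> \<psi>] cinner_commute[of "U g \<psi>" \<psi>]
  by (simp add: char_fun_def)

lemma cinner_orbit:
  assumes "group G" "unitary_rep G U" "g \<in> carrier G" "h \<in> carrier G"
  shows "cinner (U g \<psi>) (U h \<psi>) = char_fun U \<psi> (inv\<^bsub>G\<^esub> g \<otimes>\<^bsub>G\<^esub> h)"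
  using assms by (simp add: cinner_unitary_rep[OF assms(1,2)] char_fun_def unitary_rep_def group.inv_closed)

text \<open>The order of the two group elements is that of the trace of |U(k i) psi><U(k j) psi|.
  The points \<open>k i\<close> may repeat, so particular elements can be inserted without checking
  that they differ.\<close>

definition positive_definite_on :: "('g, 'm) monoid_scheme \<Rightarrow> ('g \<Rightarrow> complex) \<Rightarrow> bool" where
  "positive_definite_on G r \<longleftrightarrow> (\<forall>n k c. (\<forall>i<n. k i \<in> carrier G) \<longrightarrow>
     (\<Sum>i<n::nat. \<Sum>j<n. cnj (c i) * r (inv\<^bsub>G\<^esub> (k j) \<otimes>\<^bsub>G\<^esub> k i) * c j) \<in> \<real>\<^sub>\<ge>\<^sub>0)"

lemma positive_definite_char_fun_ratio:
  fixes \<psi> \<phi> :: "'h::complex_hilbert_space"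
  assumes G: "group G" and U: "unitary_rep G U"
    and \<phi>: "norm \<phi> = 1" "\<And>g. g \<in> carrier G \<Longrightarrow> char_fun U \<phi> g \<noteq> 0"
    and conv: "cov_convertible G U (pure_state \<psi>) (pure_state \<phi>)"
  shows "positive_definite_on G (\<lambda>g. char_fun U \<psi> g / char_fun U \<phi> g)"
  unfolding positive_definite_on_def
proof (intro allI impI)
  fix n :: nat and k :: "nat \<Rightarrow> _" and c :: "nat \<Rightarrow> complex"
  assume k: "\<forall>i<n. k i \<in> carrier G"
  obtain \<E> where \<E>: "quantum_channel \<E>" "covariant G U \<E>" "\<E> (pure_state \<psi>) = pure_state \<phi>"
    using conv unfolding cov_convertible_def by blast
  define X where "X i j = ketbra (U (k i) \<psi>) (U (k j) \<psi>)" for i j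
  define Y where "Y i j = \<E> (X i j)" for i j
  define e where "e i = U (k i) \<phi>" for i
  have X: "trace_class (X i j)" for i j
    by (simp add: X_def trace_class_ketbra)
  have "block_positive n X"
    unfolding block_positive_def
  proof
    fix v :: "nat \<Rightarrow> 'h"
    define s where "s = (\<Sum>j<n. cinner (U (k j) \<psi>) (v j))"
    have "(\<Sum>i<n. \<Sum>j<n. cinner (v i) (X i j (v j))) = cnj s * s"
      unfolding s_def cnj_sum sum_product X_def ketbra_def cinner_scaleC_right
      by (intro sum.cong refl) (metis cinner_commute mult.commute)
    also have "\<dots> = complex_of_real ((cmod s)\<^sup>2)"
      by (simp only: complex_norm_square mult.commute)
    finally show "(\<Sum>i<n. \<Sum>j<n. cinner (v i) (X i j (v j))) \<in> \<real>\<^sub>\<ge>\<^sub>0"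
      by (simp add: complex_nonneg_Reals_iff del: of_real_power)
  qed
  hence pos: "block_positive n Y"
    using \<E>(1) X unfolding quantum_channel_def completely_positive_def Y_def by blast
  have lin: "bounded_clinear (Y i j)" for i j
    using \<E>(1) X unfolding quantum_channel_def Y_def by (blast intro: trace_class_imp_bounded_clinear)
  have tr: "op_trace (Y i j) = cinner (U (k j) \<psi>) (U (k i) \<psi>)" for i j
    using \<E>(1) X[of i j] unfolding quantum_channel_def trace_preserving_def Y_def
    by (simp add: X_def op_trace_ketbra)
  have conj: "U g \<circ> pure_state x \<circ> cadjoint (U g) = ketbra (U g x) (U g x)" if g: "g \<in> carrier G" for g x
  proof (rule ext)
    fix y
    have "bounded_clinear (U g)" using U g by (auto simp: unitary_rep_def unitary_op_def)
    thus "(U g \<circ> pure_state x \<circ> cadjoint (U g)) y = ketbra (U g x) (U g x) y"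
      using cinner_unitary_rep[OF G U g, of x y]
      by (simp add: cadjoint_unitary_rep[OF G U g] pure_state_def ketbra_def bounded_clinearD(3))
  qed
  have diag: "Y i i = ketbra (e i) (e i)" if "i < n" for i
  proof -
    have ki: "k i \<in> carrier G" using k that by simp
    have "trace_class (pure_state \<psi>)" by (simp add: pure_state_eq_ketbra trace_class_ketbra)
    hence "\<E> (U (k i) \<circ> pure_state \<psi> \<circ> cadjoint (U (k i))) = U (k i) \<circ> pure_state \<phi> \<circ> cadjoint (U (k i))"
      using \<E>(2,3) ki unfolding covariant_def by metis
    thus ?thesis unfolding conj[OF ki] by (simp add: Y_def X_def e_def)
  qed
  have ne: "norm (e i) = 1" if "i < n" for i
  proof -
    have "cinner (e i) (e i) = cinner \<phi> \<phi>"
      using U k that unfolding e_def unitary_rep_def unitary_op_def by blast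
    thus ?thesis using \<phi>(1) by (metis cinner_self_eq_1_iff)
  qed
  define f where "f i j = cinner (e i) (Y i j (e j))" for i j
  have Yf: "Y i j = (\<lambda>x. f i j *\<^sub>C ketbra (e i) (e j) x)" if "i < n" "j < n" for i j
    unfolding f_def by (rule block_positive_rank_one_diagonal[OF pos lin diag ne that])
  have f: "f i j = char_fun U \<psi> (inv\<^bsub>G\<^esub> (k j) \<otimes>\<^bsub>G\<^esub> k i) / char_fun U \<phi> (inv\<^bsub>G\<^esub> (k j) \<otimes>\<^bsub>G\<^esub> k i)"
    if ij: "i < n" "j < n" for i j
  proof -
    have kij: "k i \<in> carrier G" "k j \<in> carrier G" using k ij by auto
    \<comment> \<open>A second computation of this trace, now from the rank-one form of the block;
      comparison with \<open>tr\<close> determines the scalar, and the nonvanishing of chi_phi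
      permits the division.\<close>
    have "op_trace (Y i j) = f i j * cinner (e j) (e i)"
    proof -
      have "Y i j = ketbra (f i j *\<^sub>C e i) (e j)"
        using Yf[OF ij] by (simp add: ketbra_def fun_eq_iff scaleC_scaleC mult.commute)
      thus ?thesis by (simp add: op_trace_ketbra cinner_scaleC_right)
    qed
    hence "char_fun U \<psi> (inv\<^bsub>G\<^esub> (k j) \<otimes>\<^bsub>G\<^esub> k i) = f i j * char_fun U \<phi> (inv\<^bsub>G\<^esub> (k j) \<otimes>\<^bsub>G\<^esub> k i)"
      unfolding tr e_def cinner_orbit[OF G U kij(2,1)] .
    moreover have "inv\<^bsub>G\<^esub> (k j) \<otimes>\<^bsub>G\<^esub> k i \<in> carrier G"
      using G kij by (simp add: group.inv_closed group.is_monoid monoid.m_closed)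
    ultimately show ?thesis using \<phi>(2) by (simp add: field_simps)
  qed
  \<comment> \<open>Test vectors along the \<open>e i\<close> reduce block positivity to the scalar
    quadratic form.\<close>
  have "cinner (c i *\<^sub>C e i) (Y i j (c j *\<^sub>C e j)) =
      cnj (c i) * (char_fun U \<psi> (inv\<^bsub>G\<^esub> (k j) \<otimes>\<^bsub>G\<^esub> k i) / char_fun U \<phi> (inv\<^bsub>G\<^esub> (k j) \<otimes>\<^bsub>G\<^esub> k i)) * c j"
    if "i < n" "j < n" for i j
    unfolding f[OF that, symmetric]
    by (simp add: f_def bounded_clinearD(3)[OF lin] cinner_scaleC_left cinner_scaleC_right)
  hence "(\<Sum>i<n. \<Sum>j<n. cnj (c i) * (char_fun U \<psi> (inv\<^bsub>G\<^esub> (k j) \<otimes>\<^bsub>G\<^esub> k i) /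
      char_fun U \<phi> (inv\<^bsub>G\<^esub> (k j) \<otimes>\<^bsub>G\<^esub> k i)) * c j) =
      (\<Sum>i<n. \<Sum>j<n. cinner (c i *\<^sub>C e i) (Y i j (c j *\<^sub>C e j)))"
    by (intro sum.cong refl) simp
  also have "\<dots> \<in> \<real>\<^sub>\<ge>\<^sub>0"
    by (rule pos[unfolded block_positive_def, THEN spec, of "\<lambda>i. c i *\<^sub>C e i"])
  finally show "(\<Sum>i<n. \<Sum>j<n. cnj (c i) * (char_fun U \<psi> (inv\<^bsub>G\<^esub> (k j) \<otimes>\<^bsub>G\<^esub> k i) /
      char_fun U \<phi> (inv\<^bsub>G\<^esub> (k j) \<otimes>\<^bsub>G\<^esub> k i)) * c j) \<in> \<real>\<^sub>\<ge>\<^sub>0" .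
qed

lemma positive_definite_on_cmod_le:
  assumes G: "group G" and r: "positive_definite_on G r" "r \<one>\<^bsub>G\<^esub> = 1"
    and r_cnj: "\<And>g. g \<in> carrier G \<Longrightarrow> r (inv\<^bsub>G\<^esub> g) = cnj (r g)"
    and g: "g \<in> carrier G"
  shows "cmod (r g) \<le> 1"
proof -
  interpret group G by fact
  define k where "k i = (if i = 0 then \<one>\<^bsub>G\<^esub> else g)" for i :: nat
  \<comment> \<open>With these coefficients the form equals the determinant of the 2 x 2 matrix at
    the points 1 and g.\<close>
  define c where "c i = (if i = 0 then 1 else - r g)" for i :: nat
  have "(\<Sum>i<2::nat. \<Sum>j<2. cnj (c i) * r (inv\<^bsub>G\<^esub> (k j) \<otimes>\<^bsub>G\<^esub> k i) * c j) \<in> \<real>\<^sub>\<ge>\<^sub>0"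
    using r(1) g unfolding positive_definite_on_def k_def by simp
  also have "(\<Sum>i<2::nat. \<Sum>j<2. cnj (c i) * r (inv\<^bsub>G\<^esub> (k j) \<otimes>\<^bsub>G\<^esub> k i) * c j) =
      1 - r g * cnj (r g)"
    using g by (simp add: eval_nat_numeral lessThan_Suc k_def c_def r(2) r_cnj[OF g] algebra_simps)
  also have "\<dots> = complex_of_real (1 - (cmod (r g))\<^sup>2)"
    by (simp only: complex_norm_square of_real_diff of_real_1)
  finally have "(cmod (r g))\<^sup>2 \<le> 1"
    by (simp add: complex_nonneg_Reals_iff del: of_real_diff of_real_power)
  thus ?thesis by (simp add: abs_square_le_1)
qed

text \<open>Because \<open>r g\<close> is unimodular, the coefficients 1 and \<open>- r g\<close>
  span the kernel of the corner at the points 1 and g, and their product with the third row is the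
  defect \<open>b\<close>. A third coefficient t therefore gives 2 Re(cnj t b) + |t|^2. Its minimum,
  at t = -b, is -|b|^2, so positivity forces \<open>b\<close> to vanish.\<close>

lemma positive_definite_on_unimodular_mult:
  assumes G: "group G" and r: "positive_definite_on G r" "r \<one>\<^bsub>G\<^esub> = 1"
    and r_cnj: "\<And>g. g \<in> carrier G \<Longrightarrow> r (inv\<^bsub>G\<^esub> g) = cnj (r g)"
    and gh: "g \<in> carrier G" "h \<in> carrier G" and rg: "cmod (r g) = 1"
  shows "r (g \<otimes>\<^bsub>G\<^esub> h) = r g * r h"
proof -
  interpret group G by fact
  define b where "b = r (g \<otimes>\<^bsub>G\<^esub> h) - r g * r h"
  define k where "k i = (if i = 0 then \<one>\<^bsub>G\<^esub> else if i = 1 then g else g \<otimes>\<^bsub>G\<^esub> h)" for i :: nat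
  define c where "c i = (if i = 0 then 1 else if i = 1 then - r g else - b)" for i :: nat
  have m: "inv\<^bsub>G\<^esub> g \<otimes>\<^bsub>G\<^esub> (g \<otimes>\<^bsub>G\<^esub> h) = h" "inv\<^bsub>G\<^esub> (g \<otimes>\<^bsub>G\<^esub> h) \<otimes>\<^bsub>G\<^esub> g = inv\<^bsub>G\<^esub> h"
    using gh by (simp_all add: m_assoc[symmetric] inv_mult_group) (simp add: m_assoc)
  have rr: "r g * cnj (r g) = 1" using rg by (simp add: complex_norm_square[symmetric])
  have "(\<Sum>i<3::nat. \<Sum>j<3. cnj (c i) * r (inv\<^bsub>G\<^esub> (k j) \<otimes>\<^bsub>G\<^esub> k i) * c j) \<in> \<real>\<^sub>\<ge>\<^sub>0"
    using r(1) gh unfolding positive_definite_on_def k_def by simp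
  also have "(\<Sum>i<3::nat. \<Sum>j<3. cnj (c i) * r (inv\<^bsub>G\<^esub> (k j) \<otimes>\<^bsub>G\<^esub> k i) * c j) =
      1 - r g * cnj (r g) - cnj b * (r (g \<otimes>\<^bsub>G\<^esub> h) - r g * r h)
       - b * cnj (r (g \<otimes>\<^bsub>G\<^esub> h) - r g * r h) + b * cnj b"
    using gh by (simp add: eval_nat_numeral lessThan_Suc k_def c_def r(2) m algebra_simps
        r_cnj[OF gh(1)] r_cnj[OF gh(2)] r_cnj[OF m_closed[OF gh]])
  also have "\<dots> = - complex_of_real ((cmod b)\<^sup>2)"
    unfolding b_def[symmetric] rr complex_norm_square by simp
  finally have "(cmod b)\<^sup>2 \<le> 0"
    by (simp add: complex_nonneg_Reals_iff del: of_real_power)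
  thus ?thesis by (simp add: b_def)
qed

theorem mainTheorem3:
  fixes G :: "('g, 'm) monoid_scheme"
    and U :: "'g \<Rightarrow> 'h::complex_hilbert_space \<Rightarrow> 'h"
    and \<psi> \<phi> :: 'h
  assumes "group G" and "finite (carrier G)"
    and "unitary_rep G U"
    and "norm \<psi> = 1" and "norm \<phi> = 1"
    and "\<And>g. g \<in> carrier G \<Longrightarrow> char_fun U \<psi> g \<noteq> 0"
    and "\<And>g. g \<in> carrier G \<Longrightarrow> char_fun U \<phi> g \<noteq> 0"
  shows "G_equivalent G U (pure_state \<psi>) (pure_state \<phi>) \<longleftrightarrow>
    (\<exists>\<Theta> :: 'g \<Rightarrow> real.
       unitary_rep G (\<lambda>g (z::complex). exp (\<i> * complex_of_real (\<Theta> g)) *\<^sub>C z) \<and>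
       (\<forall>g\<in>carrier G. char_fun U \<psi> g = char_fun U \<phi> g * exp (\<i> * complex_of_real (\<Theta> g))))"
proof
  assume eq: "G_equivalent G U (pure_state \<psi>) (pure_state \<phi>)"
  interpret group G by fact
  define r where "r g = char_fun U \<psi> g / char_fun U \<phi> g" for g
  \<comment> \<open>The reverse conversion makes the reciprocal ratio positive definite too, which
    bounds the modulus of \<open>r\<close> from below.\<close>
  define r' where "r' g = char_fun U \<phi> g / char_fun U \<psi> g" for g
  have pd: "positive_definite_on G r" "positive_definite_on G r'"
    using eq assms unfolding G_equivalent_def r_def[abs_def] r'_def[abs_def]
    by (auto intro: positive_definite_char_fun_ratio)
  have one: "r \<one>\<^bsub>G\<^esub> = 1" "r' \<one>\<^bsub>G\<^esub> = 1"
    using assms by (simp_all add: r_def r'_def char_fun_one)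
  have inv: "r (inv\<^bsub>G\<^esub> g) = cnj (r g)" "r' (inv\<^bsub>G\<^esub> g) = cnj (r' g)" if "g \<in> carrier G" for g
    using assms that by (simp_all add: r_def r'_def char_fun_inv)
  have cmod_r: "cmod (r g) = 1" if g: "g \<in> carrier G" for g
  proof (rule antisym)
    show "cmod (r g) \<le> 1"
      by (rule positive_definite_on_cmod_le[OF assms(1) pd(1) one(1) _ g]) (rule inv(1))
    have "cmod (r' g) \<le> 1"
      by (rule positive_definite_on_cmod_le[OF assms(1) pd(2) one(2) _ g]) (rule inv(2))
    moreover have "r' g = inverse (r g)" "r g \<noteq> 0"
      using assms(6,7)[OF g] by (simp_all add: r_def r'_def)
    ultimately show "1 \<le> cmod (r g)"
      by (simp add: norm_inverse inverse_le_1_iff)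
  qed
  have r_mult: "r (g \<otimes>\<^bsub>G\<^esub> h) = r g * r h" if "g \<in> carrier G" "h \<in> carrier G" for g h
    by (rule positive_definite_on_unimodular_mult[OF assms(1) pd(1) one(1) _ that cmod_r[OF that(1)]])
       (rule inv(1))
  \<comment> \<open>Any branch of the argument serves: multiplicativity is demanded of the
    exponential, not additivity of the angle.\<close>
  define \<Theta> where "\<Theta> g = Arg (r g)" for g
  have exp: "exp (\<i> * complex_of_real (\<Theta> g)) = r g" if "g \<in> carrier G" for g
  proof -
    have "r g \<noteq> 0" using cmod_r[OF that] by force
    from Arg_eq[OF this] show ?thesis
      unfolding \<Theta>_def cmod_r[OF that] of_real_1 mult_1 by (rule sym)
  qed
  have "unitary_op (\<lambda>z::complex. r g *\<^sub>C z)" if g: "g \<in> carrier G" for g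
    unfolding unitary_op_def
  proof (intro conjI allI)
    have rr: "r g * cnj (r g) = 1" using cmod_r[OF g] by (simp add: complex_norm_square[symmetric])
    show "bounded_clinear (\<lambda>z::complex. r g *\<^sub>C z)"
      by (rule bounded_clinear_scaleC[OF bounded_clinear_ident])
    show "surj (\<lambda>z::complex. r g *\<^sub>C z)"
    proof (rule surjI)
      show "r g *\<^sub>C (cnj (r g) *\<^sub>C z) = z" for z :: complex by (simp add: scaleC_scaleC rr)
    qed
    show "cinner (r g *\<^sub>C x) (r g *\<^sub>C y) = cinner x y" for x y :: complex
      using rr by (simp add: cinner_scaleC_left cinner_scaleC_right mult.assoc[symmetric] mult.commute)
  qed
  hence "unitary_rep G (\<lambda>g (z::complex). exp (\<i> * complex_of_real (\<Theta> g)) *\<^sub>C z)"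
    unfolding unitary_rep_def by (auto simp: exp r_mult fun_eq_iff scaleC_scaleC)
  moreover have "char_fun U \<psi> g = char_fun U \<phi> g * exp (\<i> * complex_of_real (\<Theta> g))" if "g \<in> carrier G" for g
    using assms(7)[OF that] by (simp add: exp that r_def)
  ultimately show "\<exists>\<Theta> :: 'g \<Rightarrow> real.
       unitary_rep G (\<lambda>g (z::complex). exp (\<i> * complex_of_real (\<Theta> g)) *\<^sub>C z) \<and>
       (\<forall>g\<in>carrier G. char_fun U \<psi> g = char_fun U \<phi> g * exp (\<i> * complex_of_real (\<Theta> g)))"
    by blast
next
  assume "\<exists>\<Theta> :: 'g \<Rightarrow> real.
       unitary_rep G (\<lambda>g (z::complex). exp (\<i> * complex_of_real (\<Theta> g)) *\<^sub>C z) \<and>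
       (\<forall>g\<in>carrier G. char_fun U \<psi> g = char_fun U \<phi> g * exp (\<i> * complex_of_real (\<Theta> g)))"
  then obtain \<Theta> :: "'g \<Rightarrow> real"
    where rep: "unitary_rep G (\<lambda>g (z::complex). exp (\<i> * complex_of_real (\<Theta> g)) *\<^sub>C z)"
      and char: "\<And>g. g \<in> carrier G \<Longrightarrow>
        char_fun U \<psi> g = char_fun U \<phi> g * exp (\<i> * complex_of_real (\<Theta> g))" by blast
  define \<omega> where "\<omega> g = exp (\<i> * complex_of_real (\<Theta> g))" for g
  have unimod: "\<omega> g * cnj (\<omega> g) = 1" for g
    by (simp add: \<omega>_def complex_norm_square[symmetric])
  have mult: "\<omega> (g \<otimes>\<^bsub>G\<^esub> h) = \<omega> g * \<omega> h" if gh: "g \<in> carrier G" "h \<in> carrier G" for g h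
  proof -
    have "\<omega> (g \<otimes>\<^bsub>G\<^esub> h) *\<^sub>C (1::complex) = \<omega> g *\<^sub>C (\<omega> h *\<^sub>C 1)"
      using rep gh unfolding unitary_rep_def \<omega>_def[symmetric] by (metis comp_apply)
    thus ?thesis by (simp add: scaleC_complex_def)
  qed
  have "cov_convertible G U (pure_state \<psi>) (pure_state \<phi>)"
    by (rule cov_convertible_of_phase[OF assms(1,2,3) unimod mult]) (simp_all add: char \<omega>_def)
  moreover have "cov_convertible G U (pure_state \<phi>) (pure_state \<psi>)"
  proof (rule cov_convertible_of_phase[OF assms(1,2,3), where \<omega> = "\<lambda>g. cnj (\<omega> g)"])
    show "char_fun U \<phi> g = char_fun U \<psi> g * cnj (\<omega> g)" if "g \<in> carrier G" for g
      using char[OF that] unimod[of g] by (simp add: \<omega>_def[symmetric] mult.assoc)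
  qed (use unimod mult in \<open>simp_all add: mult.commute\<close>)
  ultimately show "G_equivalent G U (pure_state \<psi>) (pure_state \<phi>)"
    by (simp add: G_equivalent_def)
qed

end
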